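(* Let $\mathbb{T}/\mathcal{I}$ be the free Hom-associative algebra with $1$-generator over $\mathbb{R}$. The exponential sequence $s\mapsto\widehat{exp}(s)$ ($s\in\mathbb{R}$) is valued in the Hom-group $G_{seq}(\mathbb{T}/\mathcal{I})$ of formal group-like sequences. Moreover: \begin{enumerate} \item $\widehat{exp}(0)$ is the unit element of the Hom-group of formal group-like sequences. \item For all $s,t\in\mathbb{R}$, $\widehat{exp}(s)\vee\widehat{exp}(t)=\alpha(\widehat{exp}(s+t))$. \item $S(\widehat{exp}(s))=\widehat{exp}(-s)$ is a strict inverse, i.e. $\widehat{exp}(s)\vee\widehat{exp}(-s)=\widehat{exp}(-s)\vee\widehat{exp}(s)=\mathbf{1}$. \end{enumerate}
   Context: The ground field is $\mathbb{R}$; $\mathbb{N}=\{0,1,2,\dots\}$. Trees. For $n\ge 1$, $T_n$ is the set of planar binary rooted trees with $n$ leaves (labelled $1,\dots,n$ left to right); $T_1=\{|\}$. Grafting $\varphi\vee\psi\in T_{p+q}$ joins the roots of $\varphi\in T_p$ (left) and $\psi\in T_q$ (right) to a new root. A leaf weighted $n$-tree is $(\varphi,a)$ with $\varphi\in T_n$, $a\in\mathbb{N}^n$; $B_n$ is the set of these; $(\varphi,a)\vee(\psi,b)=(\varphi\vee\psi,(a,b))$. $B$ is the disjoint union of all $B_n$ and one further element $\mathbf{1}$; $\mathbb{T}$ is the vector space with basis $B$. On $\mathbb{T}$: $\alpha$ is linear, $\alpha(\mathbf{1})=\mathbf{1}$, $\alpha(\varphi,a_1,\dots,a_n)=(\varphi,a_1+1,\dots,a_n+1)$;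 $\vee$ is bilinear, equal to grafting on weighted trees, with $\varphi\vee\mathbf{1}=\mathbf{1}\vee\varphi=\alpha(\varphi)$, $\mathbf{1}\vee\mathbf{1}=\mathbf{1}$. For $\varphi\in B_n$, $I\subset\{1,\dots,n\}$, $\varphi_I\in B$ is obtained by replacing leaves not in $I$ by $\mathbf{1}$ and evaluating $\vee$ ($\varphi_\emptyset=\mathbf 1$). $\Delta\varphi=\sum_{I\sqcup J=\{1,\dots,n\}}\varphi_I\otimes\varphi_J$, $\Delta(\mathbf{1})=\mathbf{1}\otimes\mathbf{1}$; $\epsilon(\mathbf{1})=1$, $\epsilon(\varphi)=0$ for $\varphi\in B_n$; $S$ is linear with $S(\mathbf{1})=\mathbf{1}$, $S(|,a)=-(|,a)$, $S(\varphi\vee\psi)=S(\psi)\vee S(\varphi)$. $\mathcal{I}\subset\mathbb{T}$ is the two-sided ideal for $\vee$ generated by all $(\phi\vee\psi)\vee\alpha(\chi)-\alpha(\phi)\vee(\psi\vee\chi)$, $\phi,\psi,\chi\in B$. All operations descend to $\mathbb{T}/\mathcal{I}$, the free Hom-associative algebra with $1$-generator. Formal group-like sequences. Let $A=\mathbb{T}/\mathcal{I}$; extend the operations to $A[\nu]$ by linearity in the formal parameter $\nu$. The invertibility index of $y\in A[\nu]$ is the smallest $k\in\mathbb N$ with $\alpha^k\circ\vee\circ(S\otimes\mathrm{id})\circ\Delta(y)=\alpha^k\circ\vee\circ(\mathrm{id}\otimes S)\circ\Delta(y)=\epsilon(y)\mathbf 1$. A $p$-order group-like element is $g(\nu)\in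 A[\nu]$ with $\Delta(g(\nu))=g(\nu)\otimes g(\nu)$ modulo $\nu^{p+1}$ and $\epsilon(g(\nu))=1$. $G_{seq}(A)$ is the set of formal group-like sequences: sequences $(g_p(\nu))_{p\in\mathbb{N}}$ in $A[\nu]$ such that (a) for $p\ge1$, $g_p(\nu)$ is a $p$-order group-like element; (b) $g_{p+1}(\nu)=\alpha(g_p(\nu))$ modulo $\nu^{p+1}$; (c) the invertibility indexes of the $g_p(\nu)$ are bounded independently of $p$. Operations $\vee,\alpha,S,\mathbf 1$ on sequences are termwise, and $p$-th terms are compared modulo $\nu^{p+1}$; with inverse $S$ this is a Hom-group (i.e. $\vee$ is Hom-associative for $\alpha$ with unit $\mathbf 1$, meaning $g\vee\mathbf 1=\mathbf 1\vee g=\alpha(g)$, and for each $g$ there is $k$ with $\alpha^k(g\vee S(g))=\alpha^k(S(g)\vee g)=\mathbf 1$). Exponential. For $\varphi\in T_i$ and $p\ge i$, $\varphi[p]$ is the leaf weighted tree in which leaf $j$ has weight $p-\ell(j)$, where $\ell(j)$ is the number of edges (including the root edge) on the path from the root to leaf $j$ (so $\ell=1$ for the $1$-tree). The class of $\varphi[p]$ in $\mathbb{T}/\mathcal{I}$ does not depend on $\varphi\in T_i$ and is denoted $\lfloor e^i\rfloor_p$. For $s\in\mathbb{R}$, $\widehat{exp}(s)=(\widehat{exp}_p(s))_{p\in\mathbb N}$ with $\widehat{exp}_p(s)=\mathbf 1+\sum_{i=1}^p\frac{s^i}{i!}\nu^i\lfloor e^i\rfloor_p$. *)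

theory Defs
  imports "HOL-Analysis.Analysis" "HOL-Analysis.Finite_Function_Topology"
    "HOL-Computational_Algebra.Polynomial"
begin

section \<open>Free vector spaces and tensor products\<close>

text \<open>The real vector space with basis \<^typ>\<open>'k\<close> is \<^typ>\<open>'k \<Rightarrow>\<^sub>0 real\<close>.\<close>

definition basis_elem :: "'k \<Rightarrow> ('k \<Rightarrow>\<^sub>0 real)" where
  "basis_elem k = Poly_Mapping.single k 1"

definition lin_ext :: "('k \<Rightarrow> 'v::real_vector) \<Rightarrow> ('k \<Rightarrow>\<^sub>0 real) \<Rightarrow> 'v" where
  "lin_ext f x = (\<Sum>k\<in>Poly_Mapping.keys x. Poly_Mapping.lookup x k *\<^sub>R f k)"

lemma lookup_scaleR_pm: "Poly_Mapping.lookup (c *\<^sub>R (x::'k \<Rightarrow>\<^sub>0 real)) k = c * Poly_Mapping.lookup x k"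
proof -
  have "finite {i. c * Poly_Mapping.lookup x i \<noteq> 0}"
    by (rule finite_subset[OF _ finite_lookup[of x]]) auto
  then show ?thesis
    by (simp add: scaleR_poly_mapping_def)
qed

lemma lin_ext_superset:
  assumes "finite K" "Poly_Mapping.keys x \<subseteq> K"
  shows "lin_ext f x = (\<Sum>k\<in>K. Poly_Mapping.lookup x k *\<^sub>R f k)"
  unfolding lin_ext_def
  by (rule sum.mono_neutral_left) (use assms in \<open>auto simp: in_keys_iff\<close>)

lemma linear_lin_ext: "linear (lin_ext (f :: 'k \<Rightarrow> 'v::real_vector))"
proof (rule linearI)
  fix x y :: "'k \<Rightarrow>\<^sub>0 real"
  let ?K = "Poly_Mapping.keys x \<union> Poly_Mapping.keys y"
  have k: "Poly_Mapping.keys (x + y) \<subseteq> ?K" by (rule Poly_Mapping.keys_add)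
  show "lin_ext f (x + y) = lin_ext f x + lin_ext f y"
    using k by (simp add: lin_ext_superset[of ?K] lookup_add scaleR_left_distrib sum.distrib)
next
  fix c :: real and x :: "'k \<Rightarrow>\<^sub>0 real"
  have "Poly_Mapping.keys (c *\<^sub>R x) \<subseteq> Poly_Mapping.keys x"
    by (auto simp: in_keys_iff lookup_scaleR_pm)
  then show "lin_ext f (c *\<^sub>R x) = c *\<^sub>R lin_ext f x"
    by (simp add: lin_ext_superset[of "Poly_Mapping.keys x"] lookup_scaleR_pm scaleR_sum_right)
qed

lemma lin_ext_basis [simp]: "lin_ext f (basis_elem k) = f k"
  by (simp add: lin_ext_def basis_elem_def)

lemma lin_ext_expand: "x = lin_ext basis_elem x"
proof (rule poly_mapping_eqI)
  fix k
  show "Poly_Mapping.lookup x k = Poly_Mapping.lookup (lin_ext basis_elem x) k"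
    by (simp add: lin_ext_def lookup_sum lookup_scaleR_pm basis_elem_def lookup_single when_def
        in_keys_iff sum.delta' if_distrib cong: if_cong)
qed

lemma linear_ext_eq:
  assumes "linear F" "linear G" "\<And>k. F (basis_elem k) = G (basis_elem k)"
  shows "F x = (G x :: 'v::real_vector)"
proof -
  have "F (lin_ext basis_elem x) = G (lin_ext basis_elem x)"
    unfolding lin_ext_def
    by (simp add: linear_sum[OF assms(1)] linear_sum[OF assms(2)] linear_scale[OF assms(1)]
        linear_scale[OF assms(2)] assms(3))
  then show ?thesis by (simp flip: lin_ext_expand)
qed

lemma bilinear_lin_ext2: "bilinear (\<lambda>x y. lin_ext (\<lambda>a. lin_ext (f a) y) x)"
  unfolding bilinear_def
proof (intro conjI allI)
  show "linear (\<lambda>y. lin_ext (\<lambda>a. lin_ext (f a) y) x)" for x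
    unfolding lin_ext_def[of _ x]
    by (intro linear_compose_sum linear_compose_scale_right ballI linear_lin_ext)
  show "linear (\<lambda>x. lin_ext (\<lambda>a. lin_ext (f a) y) x)" for y
    by (rule linear_lin_ext)
qed

lemma bilinear_ext_eq:
  assumes "bilinear F" "bilinear G" "\<And>a b. F (basis_elem a) (basis_elem b) = G (basis_elem a) (basis_elem b)"
  shows "F x y = (G x y :: 'v::real_vector)"
proof (rule linear_ext_eq[of "\<lambda>x. F x y" "\<lambda>x. G x y"])
  show "linear (\<lambda>x. F x y)" "linear (\<lambda>x. G x y)" using assms by (auto simp: bilinear_def)
  show "F (basis_elem k) y = G (basis_elem k) y" for k
    by (rule linear_ext_eq[of "F (basis_elem k)" "G (basis_elem k)"])
       (use assms in \<open>auto simp: bilinear_def\<close>)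
qed

definition tensor_relations :: "(('a::real_vector \<times> 'b::real_vector) \<Rightarrow>\<^sub>0 real) set" where
  "tensor_relations =
     {basis_elem (a + a', b) - basis_elem (a, b) - basis_elem (a', b) | a a' b. True} \<union>
     {basis_elem (a, b + b') - basis_elem (a, b) - basis_elem (a, b') | a b b'. True} \<union>
     {basis_elem (c *\<^sub>R a, b) - c *\<^sub>R basis_elem (a, b) | c a b. True} \<union>
     {basis_elem (a, c *\<^sub>R b) - c *\<^sub>R basis_elem (a, b) | c a b. True}"

definition tensor_eqv where
  "tensor_eqv x y \<longleftrightarrow> x - y \<in> span tensor_relations"

lemma equivp_mod_subspace:
  assumes "subspace V" "\<And>x y. R x y \<longleftrightarrow> x - y \<in> V"
  shows "equivp R"
proof (rule equivpI)
  show "reflp R" using assms by (auto simp: reflp_def subspace_0)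
  show "symp R" 
  proof (rule sympI)
    fix x y assume "R x y"
    then have "- (x - y) \<in> V" using assms by (blast intro: subspace_neg)
    then show "R y x" using assms by simp
  qed
  show "transp R"
  proof (rule transpI)
    fix x y z assume "R x y" "R y z"
    then have "(x - y) + (y - z) \<in> V" using assms by (blast intro: subspace_add)
    then show "R x z" using assms by simp
  qed
qed

quotient_type (overloaded) ('a, 'b) tensor =
  "('a::real_vector \<times> 'b::real_vector) \<Rightarrow>\<^sub>0 real" / tensor_eqv
  by (rule equivp_mod_subspace[OF subspace_span]) (rule tensor_eqv_def)

lemma subspace_resp:
  assumes "subspace V"
  shows "x - x' \<in> V \<Longrightarrow> y - y' \<in> V \<Longrightarrow> (x + y) - (x' + y') \<in> V"
    and "x - x' \<in> V \<Longrightarrow> y - y' \<in> V \<Longrightarrow> (x - y) - (x' - y') \<in> V"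
    and "x - x' \<in> V \<Longrightarrow> - x - (- x') \<in> V"
    and "x - x' \<in> V \<Longrightarrow> c *\<^sub>R x - c *\<^sub>R x' \<in> V"
proof -
  show "x - x' \<in> V \<Longrightarrow> y - y' \<in> V \<Longrightarrow> (x + y) - (x' + y') \<in> V"
    using subspace_add[OF assms, of "x - x'" "y - y'"] by (simp add: add_diff_add)
  show "x - x' \<in> V \<Longrightarrow> y - y' \<in> V \<Longrightarrow> (x - y) - (x' - y') \<in> V"
    using subspace_diff[OF assms, of "x - x'" "y - y'"] by (simp add: algebra_simps)
  show "x - x' \<in> V \<Longrightarrow> - x - (- x') \<in> V"
    using subspace_neg[OF assms, of "x - x'"] by simp
  show "x - x' \<in> V \<Longrightarrow> c *\<^sub>R x - c *\<^sub>R x' \<in> V"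
    using subspace_scale[OF assms, of "x - x'" c] by (simp add: scaleR_diff_right)
qed

instantiation tensor :: (real_vector, real_vector) real_vector
begin

lift_definition zero_tensor :: "('a, 'b) tensor" is 0 .
lift_definition plus_tensor :: "('a, 'b) tensor \<Rightarrow> ('a, 'b) tensor \<Rightarrow> ('a, 'b) tensor" is "(+)"
  unfolding tensor_eqv_def by (rule subspace_resp[OF subspace_span])
lift_definition minus_tensor :: "('a, 'b) tensor \<Rightarrow> ('a, 'b) tensor \<Rightarrow> ('a, 'b) tensor" is "(-)"
  unfolding tensor_eqv_def by (rule subspace_resp[OF subspace_span])
lift_definition uminus_tensor :: "('a, 'b) tensor \<Rightarrow> ('a, 'b) tensor" is "uminus"
  unfolding tensor_eqv_def by (rule subspace_resp[OF subspace_span])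
lift_definition scaleR_tensor :: "real \<Rightarrow> ('a, 'b) tensor \<Rightarrow> ('a, 'b) tensor" is "scaleR"
  unfolding tensor_eqv_def by (rule subspace_resp[OF subspace_span])

instance
  by standard
    (transfer; simp add: tensor_eqv_def span_zero algebra_simps)+

end

lift_definition tens :: "'a::real_vector \<Rightarrow> 'b::real_vector \<Rightarrow> ('a, 'b) tensor" (infixr "\<otimes>" 75)
  is "\<lambda>a b. basis_elem (a, b)" .

lemma tensor_relations_abs: "x - y \<in> tensor_relations \<Longrightarrow> abs_tensor x = abs_tensor y"
  by (simp add: tensor.abs_eq_iff tensor_eqv_def span_base)

lemma bilinear_tens: "bilinear ((\<otimes>) :: 'a::real_vector \<Rightarrow> 'b::real_vector \<Rightarrow> _)"
proof -
  have "(a + a') \<otimes> b = a \<otimes> b + a' \<otimes> b" for a a' :: 'a and b :: 'b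
    unfolding tens.abs_eq plus_tensor.abs_eq
    by (rule tensor_relations_abs, unfold tensor_relations_def diff_diff_eq[symmetric]) blast
  moreover have "a \<otimes> (b + b') = a \<otimes> b + a \<otimes> b'" for a :: 'a and b b' :: 'b
    unfolding tens.abs_eq plus_tensor.abs_eq
    by (rule tensor_relations_abs, unfold tensor_relations_def diff_diff_eq[symmetric]) blast
  moreover have "(c *\<^sub>R a) \<otimes> b = c *\<^sub>R (a \<otimes> b)" for c and a :: 'a and b :: 'b
    unfolding tens.abs_eq scaleR_tensor.abs_eq
    by (rule tensor_relations_abs, unfold tensor_relations_def) blast
  moreover have "a \<otimes> (c *\<^sub>R b) = c *\<^sub>R (a \<otimes> b)" for c and a :: 'a and b :: 'b
    unfolding tens.abs_eq scaleR_tensor.abs_eq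
    by (rule tensor_relations_abs, unfold tensor_relations_def) blast
  ultimately show ?thesis
    unfolding bilinear_def by (intro conjI allI linearI)
qed

lemma bilinear_lin_ext_relations:
  assumes f: "bilinear f" and x: "x \<in> span tensor_relations"
  shows "lin_ext (\<lambda>(a, b). f a b) x = 0"
proof -
  let ?F = "lin_ext (\<lambda>(a, b). f a b)"
  note l = linear_lin_ext[of "\<lambda>(a, b). f a b"]
  have "?F y = 0" if "y \<in> tensor_relations" for y
    using that unfolding tensor_relations_def
    by (elim UnE CollectE exE conjE)
       (simp_all only: linear_diff[OF l] linear_scale[OF l] lin_ext_basis prod.case
        bilinear_ladd[OF f] bilinear_radd[OF f] bilinear_lmul[OF f] bilinear_rmul[OF f]
        add_diff_cancel_left' diff_self)
  then show ?thesis
    using linear_eq_0_on_span[OF l _ x] by blast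
qed

text \<open>The linear map on the tensor product induced by a bilinear map; the value 0 for maps that are
  not bilinear is a dummy.\<close>

lift_definition tensor_lift ::
  "('a::real_vector \<Rightarrow> 'b::real_vector \<Rightarrow> 'c::real_vector) \<Rightarrow> ('a, 'b) tensor \<Rightarrow> 'c"
  is "\<lambda>f x. if bilinear f then lin_ext (\<lambda>(a, b). f a b) x else 0"
proof -
  fix f :: "'a \<Rightarrow> 'b \<Rightarrow> 'c" and x y :: "'a \<times> 'b \<Rightarrow>\<^sub>0 real"
  assume "tensor_eqv x y"
  then have "bilinear f \<Longrightarrow> lin_ext (\<lambda>(a, b). f a b) (x - y) = 0"
    unfolding tensor_eqv_def using bilinear_lin_ext_relations by blast
  then show "(if bilinear f then lin_ext (\<lambda>(a, b). f a b) x else 0) =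
      (if bilinear f then lin_ext (\<lambda>(a, b). f a b) y else 0)"
    by (auto simp: linear_diff[OF linear_lin_ext])
qed

lemma tensor_lift_tens: "bilinear f \<Longrightarrow> tensor_lift f (a \<otimes> b) = f a b"
  by transfer simp

lemma linear_tensor_lift: "linear (tensor_lift f)"
proof (cases "bilinear f")
  case True
  show ?thesis
    by (rule linearI; transfer)
       (simp_all add: linear_add[OF linear_lin_ext] linear_scale[OF linear_lin_ext])
next
  case False
  then have "tensor_lift f = (\<lambda>_. 0)" by (intro ext) (transfer, simp)
  then show ?thesis by (simp add: linear_zero)
qed

lemma linear_tensor_eq:
  assumes "linear F" "linear G" "\<And>a b. F (a \<otimes> b) = G (a \<otimes> b)"
  shows "F t = (G t :: 'v::real_vector)"
proof -
  have la: "linear (abs_tensor :: _ \<Rightarrow> ('a, 'b) tensor)"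
    by (rule linearI) (simp_all add: plus_tensor.abs_eq scaleR_tensor.abs_eq)
  have "(F \<circ> abs_tensor) x = (G \<circ> abs_tensor) x" for x
  proof (rule linear_ext_eq[of "F \<circ> abs_tensor" "G \<circ> abs_tensor"])
    show "linear (F \<circ> abs_tensor)" "linear (G \<circ> abs_tensor)"
      using linear_compose[OF la] assms by auto
    show "(F \<circ> abs_tensor) (basis_elem k) = (G \<circ> abs_tensor) (basis_elem k)" for k
      using assms(3)[of "fst k" "snd k"] by (simp add: tens.abs_eq)
  qed
  from this[of "rep_tensor t"] show ?thesis by (simp add: Quotient3_abs_rep[OF Quotient3_tensor])
qed

definition tensor_map ::
  "('a::real_vector \<Rightarrow> 'c::real_vector) \<Rightarrow> ('b::real_vector \<Rightarrow> 'd::real_vector) \<Rightarrow>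
   ('a, 'b) tensor \<Rightarrow> ('c, 'd) tensor" where
  "tensor_map f g = tensor_lift (\<lambda>a b. f a \<otimes> g b)"

lemma bilinear_compose2:
  assumes "bilinear h" "linear f" "linear g"
  shows "bilinear (\<lambda>a b. h (f a) (g b))"
  using assms unfolding bilinear_def
  by (auto intro: linear_compose[unfolded o_def, of f] linear_compose[unfolded o_def, of g])

lemma tensor_map_tens: "linear f \<Longrightarrow> linear g \<Longrightarrow> tensor_map f g (a \<otimes> b) = f a \<otimes> g b"
  by (simp add: tensor_map_def tensor_lift_tens bilinear_compose2[OF bilinear_tens])

lemma linear_tensor_map: "linear (tensor_map f g)"
  unfolding tensor_map_def by (rule linear_tensor_lift)


section \<open>Leaf weighted trees\<close>

text \<open>Planar binary rooted trees with leaves decorated by \<^typ>\<open>'a\<close>. The elements of $T_n$ are the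
  \<open>unit ltree\<close>s with \<open>n\<close> leaves; a leaf weighted tree $(\varphi,a)$ is a \<open>nat ltree\<close>, with the
  weights $a_1,\dots,a_n$ attached to the leaves from left to right.\<close>

datatype 'a ltree = Leaf 'a | Graft "'a ltree" "'a ltree"

primrec leaves :: "'a ltree \<Rightarrow> nat" where
  "leaves (Leaf a) = 1"
| "leaves (Graft l r) = leaves l + leaves r"

datatype hbasis = One | Tree "nat ltree"

primrec bshift :: "hbasis \<Rightarrow> hbasis" where
  "bshift One = One"
| "bshift (Tree t) = Tree (map_ltree Suc t)"

fun bvee :: "hbasis \<Rightarrow> hbasis \<Rightarrow> hbasis" where
  "bvee (Tree s) (Tree t) = Tree (Graft s t)"
| "bvee One b = bshift b"
| "bvee a One = bshift a"

text \<open>\<open>restr t I\<close> is $t_I$; the leaves of the right branch of \<open>Graft l r\<close> are numbered from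
  \<open>leaves l + 1\<close> on.\<close>

primrec restr :: "nat ltree \<Rightarrow> nat set \<Rightarrow> hbasis" where
  "restr (Leaf a) I = (if 1 \<in> I then Tree (Leaf a) else One)"
| "restr (Graft l r) I = bvee (restr l I) (restr r {j. leaves l + j \<in> I})"

text \<open>$\mathbb T$ and its operations; \<open>hbasis\<close> is the basis $B$, with \<open>One\<close> the element
  $\mathbf 1$.\<close>

type_synonym hvec = "hbasis \<Rightarrow>\<^sub>0 real"

definition T_alpha :: "hvec \<Rightarrow> hvec" where
  "T_alpha = lin_ext (\<lambda>b. basis_elem (bshift b))"

definition T_vee :: "hvec \<Rightarrow> hvec \<Rightarrow> hvec" where
  "T_vee x y = lin_ext (\<lambda>a. lin_ext (\<lambda>b. basis_elem (bvee a b)) y) x"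

definition T_eps :: "hvec \<Rightarrow> real" where
  "T_eps = lin_ext (\<lambda>b. case b of One \<Rightarrow> 1 | Tree t \<Rightarrow> 0)"

primrec tree_antipode :: "nat ltree \<Rightarrow> hvec" where
  "tree_antipode (Leaf a) = - basis_elem (Tree (Leaf a))"
| "tree_antipode (Graft l r) = T_vee (tree_antipode r) (tree_antipode l)"

definition T_S :: "hvec \<Rightarrow> hvec" where
  "T_S = lin_ext (\<lambda>b. case b of One \<Rightarrow> basis_elem One | Tree t \<Rightarrow> tree_antipode t)"

definition T_Delta :: "hvec \<Rightarrow> (hvec, hvec) tensor" where
  "T_Delta = lin_ext (\<lambda>b. case b of
      One \<Rightarrow> basis_elem One \<otimes> basis_elem One
    | Tree t \<Rightarrow> (\<Sum>I\<in>Pow {1..leaves t}.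
        basis_elem (restr t I) \<otimes> basis_elem (restr t ({1..leaves t} - I))))"


section \<open>The free Hom-associative algebra with one generator\<close>

text \<open>The two-sided ideal $\mathcal I$; the generators range over all of $B$, including
  $\mathbf 1$.\<close>

inductive_set hideal :: "hvec set" where
  gen: "T_vee (T_vee (basis_elem a) (basis_elem b)) (T_alpha (basis_elem c))
      - T_vee (T_alpha (basis_elem a)) (T_vee (basis_elem b) (basis_elem c)) \<in> hideal"
| zero: "0 \<in> hideal"
| add: "x \<in> hideal \<Longrightarrow> y \<in> hideal \<Longrightarrow> x + y \<in> hideal"
| scale: "x \<in> hideal \<Longrightarrow> r *\<^sub>R x \<in> hideal"
| left: "x \<in> hideal \<Longrightarrow> T_vee y x \<in> hideal"
| right: "x \<in> hideal \<Longrightarrow> T_vee x y \<in> hideal"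

lemma subspace_hideal: "subspace hideal"
  by (auto simp: subspace_def intro: hideal.intros)

definition halg_eqv :: "hvec \<Rightarrow> hvec \<Rightarrow> bool" where
  "halg_eqv x y \<longleftrightarrow> x - y \<in> hideal"

quotient_type halg = hvec / halg_eqv
  by (rule equivp_mod_subspace[OF subspace_hideal]) (rule halg_eqv_def)

instantiation halg :: real_vector
begin

lift_definition zero_halg :: halg is 0 .
lift_definition plus_halg :: "halg \<Rightarrow> halg \<Rightarrow> halg" is "(+)"
  unfolding halg_eqv_def by (rule subspace_resp[OF subspace_hideal])
lift_definition minus_halg :: "halg \<Rightarrow> halg \<Rightarrow> halg" is "(-)"
  unfolding halg_eqv_def by (rule subspace_resp[OF subspace_hideal])
lift_definition uminus_halg :: "halg \<Rightarrow> halg" is "uminus"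
  unfolding halg_eqv_def by (rule subspace_resp[OF subspace_hideal])
lift_definition scaleR_halg :: "real \<Rightarrow> halg \<Rightarrow> halg" is "scaleR"
  unfolding halg_eqv_def by (rule subspace_resp[OF subspace_hideal])

instance
  by standard
    (transfer; simp add: halg_eqv_def hideal.zero algebra_simps)+

end

definition hclass :: "hvec \<Rightarrow> halg" where
  "hclass = abs_halg"

definition hone :: halg where
  "hone = hclass (basis_elem One)"

lemma linear_hclass: "linear hclass"
  by (rule linearI) (simp_all add: hclass_def plus_halg.abs_eq scaleR_halg.abs_eq)

lemma hclass_eq_0: "hclass x = 0 \<longleftrightarrow> x \<in> hideal"
  by (simp add: hclass_def zero_halg_def halg.abs_eq_iff halg_eqv_def)

lemma bilinear_T_vee: "bilinear T_vee"
  unfolding T_vee_def by (rule bilinear_lin_ext2)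

lemma T_vee_basis [simp]: "T_vee (basis_elem a) (basis_elem b) = basis_elem (bvee a b)"
  by (simp add: T_vee_def)

lemma T_alpha_basis [simp]: "T_alpha (basis_elem b) = basis_elem (bshift b)"
  by (simp add: T_alpha_def)

lemma linear_T_alpha: "linear T_alpha"
  unfolding T_alpha_def by (rule linear_lin_ext)

lemma T_one_vee: "T_vee (basis_elem One) x = T_alpha x"
  by (rule linear_ext_eq[OF _ linear_T_alpha]) (use bilinear_T_vee in \<open>auto simp: bilinear_def\<close>)

lemma bvee_One [simp]: "bvee b One = bshift b"
  by (cases b) auto

lemma T_vee_one: "T_vee x (basis_elem One) = T_alpha x"
  by (rule linear_ext_eq[of "\<lambda>x. T_vee x (basis_elem One)", OF _ linear_T_alpha])
     (use bilinear_T_vee in \<open>auto simp: bilinear_def\<close>)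

subsection \<open>The operations descend to the quotient\<close>

lift_definition halpha :: "halg \<Rightarrow> halg" is T_alpha
  unfolding halg_eqv_def
  by (simp add: T_one_vee[symmetric] bilinear_rsub[OF bilinear_T_vee, symmetric] hideal.left)

lift_definition hvee :: "halg \<Rightarrow> halg \<Rightarrow> halg" (infixl "\<curlyvee>" 70) is T_vee
proof -
  fix x x' y y'
  assume "halg_eqv x x'" "halg_eqv y y'"
  then have "T_vee (x - x') y + T_vee x' (y - y') \<in> hideal"
    unfolding halg_eqv_def by (intro hideal.add hideal.left hideal.right)
  moreover have "T_vee (x - x') y + T_vee x' (y - y') = T_vee x y - T_vee x' y'"
    by (simp add: bilinear_lsub[OF bilinear_T_vee] bilinear_rsub[OF bilinear_T_vee])
  ultimately show "halg_eqv (T_vee x y) (T_vee x' y')"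
    by (simp add: halg_eqv_def)
qed

lemma hclass_vee: "hclass x \<curlyvee> hclass y = hclass (T_vee x y)"
  by (simp add: hclass_def hvee.abs_eq)

lemma halpha_hclass: "halpha (hclass x) = hclass (T_alpha x)"
  by (simp add: hclass_def halpha.abs_eq)

lemma hclass_surj: "\<exists>x. y = hclass x"
  by (rule exI[of _ "rep_halg y"]) (simp add: hclass_def Quotient3_abs_rep[OF Quotient3_halg])

lemma linear_halpha: "linear halpha"
  by (rule linearI; transfer)
     (simp_all add: linear_add[OF linear_T_alpha] linear_scale[OF linear_T_alpha] halg_eqv_def hideal.zero)

lemma bilinear_hvee: "bilinear (\<curlyvee>)"
  unfolding bilinear_def
  by (intro conjI allI linearI; transfer)
     (simp_all add: bilinear_ladd[OF bilinear_T_vee] bilinear_radd[OF bilinear_T_vee]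
       bilinear_lmul[OF bilinear_T_vee] bilinear_rmul[OF bilinear_T_vee] halg_eqv_def hideal.zero)

lemma hone_vee: "hone \<curlyvee> x = halpha x"
  unfolding hone_def using hclass_surj[of x] by (auto simp: hclass_vee halpha_hclass T_one_vee)

lemma vee_hone: "x \<curlyvee> hone = halpha x"
  unfolding hone_def using hclass_surj[of x] by (auto simp: hclass_vee halpha_hclass T_vee_one)

lemma trilinear_ext_eq:
  fixes F G :: "('a \<Rightarrow>\<^sub>0 real) \<Rightarrow> ('b \<Rightarrow>\<^sub>0 real) \<Rightarrow> ('c \<Rightarrow>\<^sub>0 real) \<Rightarrow> 'v::real_vector"
  assumes "\<And>y z. linear (\<lambda>x. F x y z)" "\<And>x. bilinear (F x)"
    "\<And>y z. linear (\<lambda>x. G x y z)" "\<And>x. bilinear (G x)"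
    "\<And>a b c. F (basis_elem a) (basis_elem b) (basis_elem c) = G (basis_elem a) (basis_elem b) (basis_elem c)"
  shows "F x y z = G x y z"
proof -
  have "F (basis_elem a) y z = G (basis_elem a) y z" for a
    by (rule bilinear_ext_eq[OF assms(2) assms(4)]) (rule assms(5))
  then show ?thesis
    by (rule linear_ext_eq[OF assms(1) assms(3)])
qed

lemma hvee_hom_assoc: "(x \<curlyvee> y) \<curlyvee> halpha z = halpha x \<curlyvee> (y \<curlyvee> z)"
proof -
  obtain x' y' z' where e: "x = hclass x'" "y = hclass y'" "z = hclass z'"
    using hclass_surj[of x] hclass_surj[of y] hclass_surj[of z] by blast
  note bl = bilinear_T_vee[unfolded bilinear_def]
  note lin = linear_compose[unfolded o_def]
  have "hclass (T_vee (T_vee x' y') (T_alpha z')) = hclass (T_vee (T_alpha x') (T_vee y' z'))"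
  proof (rule trilinear_ext_eq[of "\<lambda>x' y' z'. hclass (T_vee (T_vee x' y') (T_alpha z'))"
        "\<lambda>x' y' z'. hclass (T_vee (T_alpha x') (T_vee y' z'))"])
    show "linear (\<lambda>x. hclass (T_vee (T_vee x y) (T_alpha z)))" for y z
      by (rule lin[OF lin[of "\<lambda>x. T_vee x y" "\<lambda>x. T_vee x (T_alpha z)"] linear_hclass]) (use bl in auto)
    show "linear (\<lambda>x. hclass (T_vee (T_alpha x) (T_vee y z)))" for y z
      by (rule lin[OF lin[OF linear_T_alpha, of "\<lambda>x. T_vee x (T_vee y z)"] linear_hclass]) (use bl in auto)
    show "bilinear (\<lambda>y z. hclass (T_vee (T_vee x y) (T_alpha z)))" for x
      unfolding bilinear_def
    proof (intro conjI allI)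
      show "linear (\<lambda>z. hclass (T_vee (T_vee x y) (T_alpha z)))" for y
        by (rule lin[OF lin[OF linear_T_alpha] linear_hclass]) (use bl in auto)
      show "linear (\<lambda>y. hclass (T_vee (T_vee x y) (T_alpha z)))" for z
        by (rule lin[OF lin[of "\<lambda>y. T_vee x y" "\<lambda>y. T_vee y (T_alpha z)"] linear_hclass]) (use bl in auto)
    qed
    show "bilinear (\<lambda>y z. hclass (T_vee (T_alpha x) (T_vee y z)))" for x
      unfolding bilinear_def
    proof (intro conjI allI)
      show "linear (\<lambda>z. hclass (T_vee (T_alpha x) (T_vee y z)))" for y
        by (rule lin[OF lin[of "\<lambda>z. T_vee y z" "\<lambda>z. T_vee (T_alpha x) z"] linear_hclass]) (use bl in auto)
      show "linear (\<lambda>y. hclass (T_vee (T_alpha x) (T_vee y z)))" for z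
        by (rule lin[OF lin[of "\<lambda>y. T_vee y z" "\<lambda>y. T_vee (T_alpha x) y"] linear_hclass]) (use bl in auto)
    qed
    show "hclass (T_vee (T_vee (basis_elem a) (basis_elem b)) (T_alpha (basis_elem c))) =
       hclass (T_vee (T_alpha (basis_elem a)) (T_vee (basis_elem b) (basis_elem c)))" for a b c
      using hclass_eq_0[THEN iffD2, OF hideal.gen[of a b c]] by (simp add: linear_diff[OF linear_hclass])
  qed
  then show ?thesis by (simp add: e hclass_vee halpha_hclass)
qed

lemma linear_T_eps: "linear T_eps"
  unfolding T_eps_def by (rule linear_lin_ext)

lemma T_eps_vee: "T_eps (T_vee x y) = T_eps x * T_eps y"
proof (rule bilinear_ext_eq[of "\<lambda>x y. T_eps (T_vee x y)" "\<lambda>x y. T_eps x * T_eps y"])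
  show "bilinear (\<lambda>x y. T_eps (T_vee x y))"
    using bilinear_T_vee linear_compose[unfolded o_def, OF _ linear_T_eps] by (auto simp: bilinear_def)
  show "bilinear (\<lambda>x y. T_eps x * T_eps y)"
    by (rule bilinear_compose2[OF bilinear_times linear_T_eps linear_T_eps])
  show "T_eps (T_vee (basis_elem a) (basis_elem b)) = T_eps (basis_elem a) * T_eps (basis_elem b)" for a b
    by (cases a; cases b) (auto simp: T_eps_def)
qed

lift_definition heps :: "halg \<Rightarrow> real" is T_eps
proof -
  have "x \<in> hideal \<Longrightarrow> T_eps x = 0" for x
  proof (induction rule: hideal.induct)
    case (gen a b c)
    have "T_eps (T_alpha z) = T_eps z" for z
      by (simp add: T_one_vee[symmetric] T_eps_vee) (simp add: T_eps_def)
    then show ?case by (simp add: linear_diff[OF linear_T_eps] T_eps_vee del: T_vee_basis T_alpha_basis)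
  qed (auto simp: linear_0[OF linear_T_eps] linear_add[OF linear_T_eps] linear_scale[OF linear_T_eps] T_eps_vee)
  then show "halg_eqv x y \<Longrightarrow> T_eps x = T_eps y" for x y
    unfolding halg_eqv_def using linear_diff[OF linear_T_eps, of x y] by fastforce
qed

lemma linear_T_S: "linear T_S"
  unfolding T_S_def by (rule linear_lin_ext)

lemma T_S_basis [simp]: "T_S (basis_elem One) = basis_elem One" "T_S (basis_elem (Tree t)) = tree_antipode t"
  by (simp_all add: T_S_def)

lemma bshift_bvee: "bshift (bvee a b) = bvee (bshift a) (bshift b)"
  by (cases a; cases b) auto

lemma T_alpha_vee: "T_alpha (T_vee x y) = T_vee (T_alpha x) (T_alpha y)"
proof (rule bilinear_ext_eq[of "\<lambda>x y. T_alpha (T_vee x y)" "\<lambda>x y. T_vee (T_alpha x) (T_alpha y)"])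
  show "bilinear (\<lambda>x y. T_alpha (T_vee x y))"
    using bilinear_T_vee linear_compose[unfolded o_def, OF _ linear_T_alpha] by (auto simp: bilinear_def)
  show "bilinear (\<lambda>x y. T_vee (T_alpha x) (T_alpha y))"
    by (rule bilinear_compose2[OF bilinear_T_vee linear_T_alpha linear_T_alpha])
qed (simp add: bshift_bvee)

lemma tree_antipode_shift: "tree_antipode (map_ltree Suc t) = T_alpha (tree_antipode t)"
  by (induction t) (auto simp: T_alpha_vee linear_neg[OF linear_T_alpha])

lemma T_S_vee: "T_S (T_vee x y) = T_vee (T_S y) (T_S x)"
proof (rule bilinear_ext_eq[of "\<lambda>x y. T_S (T_vee x y)" "\<lambda>x y. T_vee (T_S y) (T_S x)"])
  show "bilinear (\<lambda>x y. T_S (T_vee x y))"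
    using bilinear_T_vee linear_compose[unfolded o_def, OF _ linear_T_S] by (auto simp: bilinear_def)
  show "bilinear (\<lambda>x y. T_vee (T_S y) (T_S x))"
    using bilinear_compose2[OF bilinear_T_vee linear_T_S linear_T_S] by (auto simp: bilinear_def)
  show "T_S (T_vee (basis_elem a) (basis_elem b)) = T_vee (T_S (basis_elem b)) (T_S (basis_elem a))" for a b
    by (cases a; cases b) (auto simp: tree_antipode_shift T_one_vee T_vee_one)
qed

lift_definition hS :: "halg \<Rightarrow> halg" is T_S
proof -
  have "x \<in> hideal \<Longrightarrow> hclass (T_S x) = 0" for x
  proof (induction rule: hideal.induct)
    case (gen a b c)
    have al: "T_S (T_alpha z) = T_alpha (T_S z)" for z
      by (simp add: T_one_vee[symmetric] T_S_vee T_vee_one)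
    show ?case
      by (simp only: linear_diff[OF linear_T_S] T_S_vee al linear_diff[OF linear_hclass] hclass_vee[symmetric]
          halpha_hclass[symmetric] hvee_hom_assoc) simp
  next
    case (left x y)
    then show ?case by (simp add: T_S_vee hclass_vee[symmetric] bilinear_lzero[OF bilinear_hvee])
  next
    case (right x y)
    then show ?case by (simp add: T_S_vee hclass_vee[symmetric] bilinear_rzero[OF bilinear_hvee])
  qed (auto simp: linear_0[OF linear_T_S] linear_add[OF linear_T_S] linear_scale[OF linear_T_S]
      linear_0[OF linear_hclass] linear_add[OF linear_hclass] linear_scale[OF linear_hclass])
  then show "halg_eqv x y \<Longrightarrow> halg_eqv (T_S x) (T_S y)" for x y
    unfolding halg_eqv_def by (simp add: linear_diff[OF linear_T_S, symmetric] hclass_eq_0)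
qed

definition tensor_vee :: "(halg, halg) tensor \<Rightarrow> (halg, halg) tensor \<Rightarrow> (halg, halg) tensor" where
  "tensor_vee t u = tensor_lift (\<lambda>a b. tensor_map ((\<curlyvee>) a) ((\<curlyvee>) b) u) t"

lemma linear_hvee: "linear ((\<curlyvee>) a)" "linear (\<lambda>x. x \<curlyvee> a)"
  using bilinear_hvee by (auto simp: bilinear_def)

lemma bilinear_tensor_vee_aux: "bilinear (\<lambda>a b. tensor_map ((\<curlyvee>) a) ((\<curlyvee>) b) u)"
  unfolding bilinear_def
proof (intro conjI allI linearI)
  note t = linear_tensor_eq[OF linear_tensor_map]
  note s = tensor_map_tens[OF linear_hvee(1) linear_hvee(1)]
  note i = linear_compose_add linear_compose_scale_right linear_tensor_map
  show "tensor_map ((\<curlyvee>) a) ((\<curlyvee>) (b + b')) u =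
      tensor_map ((\<curlyvee>) a) ((\<curlyvee>) b) u + tensor_map ((\<curlyvee>) a) ((\<curlyvee>) b') u" for a b b'
    by (rule t, intro i) (unfold s, simp only: bilinear_ladd[OF bilinear_hvee] bilinear_radd[OF bilinear_tens])
  show "tensor_map ((\<curlyvee>) (a + a')) ((\<curlyvee>) b) u =
      tensor_map ((\<curlyvee>) a) ((\<curlyvee>) b) u + tensor_map ((\<curlyvee>) a') ((\<curlyvee>) b) u" for a a' b
    by (rule t, intro i) (unfold s, simp only: bilinear_ladd[OF bilinear_hvee] bilinear_ladd[OF bilinear_tens])
  show "tensor_map ((\<curlyvee>) a) ((\<curlyvee>) (c *\<^sub>R b)) u = c *\<^sub>R tensor_map ((\<curlyvee>) a) ((\<curlyvee>) b) u" for a b c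
    by (rule t, intro i) (unfold s, simp only: bilinear_lmul[OF bilinear_hvee] bilinear_rmul[OF bilinear_tens])
  show "tensor_map ((\<curlyvee>) (c *\<^sub>R a)) ((\<curlyvee>) b) u = c *\<^sub>R tensor_map ((\<curlyvee>) a) ((\<curlyvee>) b) u" for a b c
    by (rule t, intro i) (unfold s, simp only: bilinear_lmul[OF bilinear_hvee] bilinear_lmul[OF bilinear_tens])
qed

lemma tensor_vee_tens_left: "tensor_vee (a \<otimes> b) u = tensor_map ((\<curlyvee>) a) ((\<curlyvee>) b) u"
  unfolding tensor_vee_def by (rule tensor_lift_tens[OF bilinear_tensor_vee_aux])

lemma bilinear_tensor_vee: "bilinear tensor_vee"
proof -
  have l: "linear (\<lambda>t. tensor_vee t u)" for u
    unfolding tensor_vee_def by (rule linear_tensor_lift)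
  have "linear (tensor_vee t)" for t
  proof (rule linearI)
    show "tensor_vee t (u + v) = tensor_vee t u + tensor_vee t v" for u v
      by (rule linear_tensor_eq[OF l], intro linear_compose_add l)
         (simp only: tensor_vee_tens_left linear_add[OF linear_tensor_map])
    show "tensor_vee t (c *\<^sub>R u) = c *\<^sub>R tensor_vee t u" for c u
      by (rule linear_tensor_eq[OF l], intro linear_compose_scale_right l)
         (simp only: tensor_vee_tens_left linear_scale[OF linear_tensor_map])
  qed
  with l show ?thesis by (simp add: bilinear_def)
qed

lemma tensor_vee_tens: "tensor_vee (a \<otimes> b) (c \<otimes> d) = (a \<curlyvee> c) \<otimes> (b \<curlyvee> d)"
  by (simp only: tensor_vee_tens_left tensor_map_tens[OF linear_hvee(1) linear_hvee(1)])

lemma tensor_vee_hom_assoc: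
  "tensor_vee (tensor_vee t u) (tensor_vee (hone \<otimes> hone) v) =
   tensor_vee (tensor_vee (hone \<otimes> hone) t) (tensor_vee u v)"
proof -
  note bl = bilinear_tensor_vee[unfolded bilinear_def]
  note L = bl[THEN conjunct2, rule_format] and R = bl[THEN conjunct1, rule_format]
  note lin = linear_compose[unfolded o_def]
  let ?o = "hone \<otimes> hone"
  have p: "tensor_vee (tensor_vee (a \<otimes> a') (b \<otimes> b')) (tensor_vee ?o (c \<otimes> c')) =
      tensor_vee (tensor_vee ?o (a \<otimes> a')) (tensor_vee (b \<otimes> b') (c \<otimes> c'))" for a a' b b' c c'
    by (simp add: tensor_vee_tens hone_vee hvee_hom_assoc)
  have q: "tensor_vee (tensor_vee (a \<otimes> a') (b \<otimes> b')) (tensor_vee ?o v) =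
      tensor_vee (tensor_vee ?o (a \<otimes> a')) (tensor_vee (b \<otimes> b') v)" for a a' b b'
    by (rule linear_tensor_eq[OF lin[OF R R] lin[OF R R]]) (rule p)
  have r: "tensor_vee (tensor_vee (a \<otimes> a') u) (tensor_vee ?o v) =
      tensor_vee (tensor_vee ?o (a \<otimes> a')) (tensor_vee u v)" for a a'
    by (rule linear_tensor_eq[OF lin[OF R L] lin[OF L R]]) (rule q)
  show ?thesis
    by (rule linear_tensor_eq[OF lin[OF L L] lin[OF R L]]) (rule r)
qed

definition T_Delta_class :: "hvec \<Rightarrow> (halg, halg) tensor" where
  "T_Delta_class x = tensor_map hclass hclass (T_Delta x)"

lemma linear_T_Delta_class: "linear T_Delta_class"
  unfolding T_Delta_class_def T_Delta_def
  by (rule linear_compose[unfolded o_def, OF linear_lin_ext linear_tensor_map])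

lemma T_Delta_class_One: "T_Delta_class (basis_elem One) = hone \<otimes> hone"
  by (simp add: T_Delta_class_def T_Delta_def tensor_map_tens linear_hclass hone_def)

abbreviation bcls :: "hbasis \<Rightarrow> halg" where "bcls b \<equiv> hclass (basis_elem b)"

lemma T_Delta_class_Tree: "T_Delta_class (basis_elem (Tree t)) =
    (\<Sum>I\<in>Pow {1..leaves t}. bcls (restr t I) \<otimes> bcls (restr t ({1..leaves t} - I)))"
  by (simp add: T_Delta_class_def T_Delta_def tensor_map_tens linear_hclass linear_sum[OF linear_tensor_map])

lemma leaves_map [simp]: "leaves (map_ltree f t) = leaves t"
  by (induction t) auto

lemma restr_shift: "restr (map_ltree Suc t) I = bshift (restr t I)"
  by (induction t arbitrary: I) (auto simp: bshift_bvee)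

lemma restr_cong:
  "(\<And>i. 1 \<le> i \<Longrightarrow> i \<le> leaves t \<Longrightarrow> i \<in> I \<longleftrightarrow> i \<in> J) \<Longrightarrow> restr t I = restr t J"
proof (induction t arbitrary: I J)
  case (Leaf a)
  from Leaf[of 1] show ?case by simp
next
  case (Graft l r)
  have "restr l I = restr l J"
    by (rule Graft.IH(1)) (rule Graft.prems, auto)
  moreover have "restr r {j. leaves l + j \<in> I} = restr r {j. leaves l + j \<in> J}"
    by (rule Graft.IH(2), unfold mem_Collect_eq) (rule Graft.prems, auto)
  ultimately show ?case by simp
qed

lemma tensor_vee_sum:
  "tensor_vee (sum f A) (sum g B) = (\<Sum>i\<in>A. \<Sum>j\<in>B. tensor_vee (f i) (g j))"
proof -
  note bl = bilinear_tensor_vee[unfolded bilinear_def]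
  show ?thesis
    by (subst linear_sum[OF bl[THEN conjunct2, rule_format]])
       (simp only: linear_sum[OF bl[THEN conjunct1, rule_format]])
qed

lemma bcls_vee: "bcls a \<curlyvee> bcls b = bcls (bvee a b)"
  by (simp add: hclass_vee)

lemma T_Delta_class_Graft: "T_Delta_class (basis_elem (Tree (Graft s t))) =
    tensor_vee (T_Delta_class (basis_elem (Tree s))) (T_Delta_class (basis_elem (Tree t)))"
proof -
  define n m where "n = leaves s" and "m = leaves t"
  let ?u = "\<lambda>(I, J). I \<union> (\<lambda>j. n + j) ` J"
  let ?f = "\<lambda>K. bcls (restr (Graft s t) K) \<otimes> bcls (restr (Graft s t) ({1..n + m} - K))"
  have bij: "bij_betw ?u (Pow {1..n} \<times> Pow {1..m}) (Pow {1..n + m})"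
  proof (rule bij_betw_byWitness[where f' = "\<lambda>K. (K \<inter> {1..n}, {j. n + j \<in> K} - {0})"])
    show "\<forall>a\<in>Pow {1..n} \<times> Pow {1..m}. ((\<lambda>K. (K \<inter> {1..n}, {j. n + j \<in> K} - {0})) (?u a)) = a"
      by (auto; force)
    show "\<forall>K\<in>Pow {1..n + m}. ?u (K \<inter> {1..n}, {j. n + j \<in> K} - {0}) = K"
    proof
      fix K assume K: "K \<in> Pow {1..n + m}"
      have "x \<in> (\<lambda>j. n + j) ` ({j. n + j \<in> K} - {0})" if "x \<in> K" "x \<notin> {1..n}" for x
        using that K by (intro image_eqI[of _ _ "x - n"]) auto
      then show "?u (K \<inter> {1..n}, {j. n + j \<in> K} - {0}) = K" by (unfold prod.case) blast
    qed
  qed (auto 4 3)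
  have "T_Delta_class (basis_elem (Tree (Graft s t))) = (\<Sum>K\<in>Pow {1..n + m}. ?f K)"
    by (simp add: T_Delta_class_Tree n_def m_def)
  also have "\<dots> = (\<Sum>p\<in>Pow {1..n} \<times> Pow {1..m}. ?f (?u p))"
    by (rule sum.reindex_bij_betw[OF bij, symmetric])
  also have "\<dots> = (\<Sum>(I, J)\<in>Pow {1..n} \<times> Pow {1..m}.
     tensor_vee (bcls (restr s I) \<otimes> bcls (restr s ({1..n} - I)))
       (bcls (restr t J) \<otimes> bcls (restr t ({1..m} - J))))"
  proof (rule sum.cong[OF refl])
    fix p assume "p \<in> Pow {1..n} \<times> Pow {1..m}"
    then obtain I J where p: "p = (I, J)" and I: "I \<subseteq> {1..n}" and J: "J \<subseteq> {1..m}"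
      by blast
    let ?K = "I \<union> (\<lambda>j. n + j) ` J"
    have "restr s ?K = restr s I" "restr s ({1..n+m} - ?K) = restr s ({1..n} - I)"
      using I J by (auto intro!: restr_cong simp: n_def subset_iff)
    moreover have "restr t {j. n + j \<in> ?K} = restr t J"
      "restr t {j. n + j \<in> {1..n+m} - ?K} = restr t ({1..m} - J)"
      using I J by (auto intro!: restr_cong simp: m_def subset_iff)
    ultimately show "?f (?u p) = (case p of (I, J) \<Rightarrow>
       tensor_vee (bcls (restr s I) \<otimes> bcls (restr s ({1..n} - I)))
         (bcls (restr t J) \<otimes> bcls (restr t ({1..m} - J))))"
      by (simp add: p tensor_vee_tens bcls_vee n_def)
  qed
  also have "\<dots> = tensor_vee (T_Delta_class (basis_elem (Tree s))) (T_Delta_class (basis_elem (Tree t)))"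
    by (simp add: T_Delta_class_Tree tensor_vee_sum sum.cartesian_product n_def m_def)
  finally show ?thesis .
qed

lemma T_Delta_class_vee: "T_Delta_class (T_vee x y) = tensor_vee (T_Delta_class x) (T_Delta_class y)"
proof (rule bilinear_ext_eq[of "\<lambda>x y. T_Delta_class (T_vee x y)"
      "\<lambda>x y. tensor_vee (T_Delta_class x) (T_Delta_class y)"])
  show "bilinear (\<lambda>x y. T_Delta_class (T_vee x y))"
    using bilinear_T_vee linear_compose[unfolded o_def, OF _ linear_T_Delta_class] by (auto simp: bilinear_def)
  show "bilinear (\<lambda>x y. tensor_vee (T_Delta_class x) (T_Delta_class y))"
    by (rule bilinear_compose2[OF bilinear_tensor_vee linear_T_Delta_class linear_T_Delta_class])
  note bl = bilinear_tensor_vee[unfolded bilinear_def]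
  note L = bl[THEN conjunct2, rule_format] and R = bl[THEN conjunct1, rule_format]
  have 1: "hone \<curlyvee> bcls b = bcls (bshift b)" "bcls b \<curlyvee> hone = bcls (bshift b)" for b
    by (auto simp: hone_vee vee_hone halpha_hclass)
  have 2: "hone \<curlyvee> hone = hone"
    by (simp add: hone_def bcls_vee)
  show "T_Delta_class (T_vee (basis_elem a) (basis_elem b)) =
      tensor_vee (T_Delta_class (basis_elem a)) (T_Delta_class (basis_elem b))" for a b
  proof (cases a)
    case One
    show ?thesis
      by (cases b) (simp_all add: One T_Delta_class_One T_Delta_class_Tree linear_sum[OF R] tensor_vee_tens 1 2
          restr_shift)
  next
    case (Tree t)
    show ?thesis
      by (cases b) (simp_all add: Tree T_Delta_class_One T_Delta_class_Graft,
          simp add: T_Delta_class_Tree linear_sum[OF L] tensor_vee_tens 1 restr_shift)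
  qed
qed

text \<open>\<open>T_Delta_class\<close> is the composition of \<open>T_Delta\<close> with the projection
  $\mathbb T\otimes\mathbb T\to\mathbb T/\mathcal I\otimes\mathbb T/\mathcal I$.\<close>

lift_definition hDelta :: "halg \<Rightarrow> (halg, halg) tensor" is T_Delta_class
proof -
  have "x \<in> hideal \<Longrightarrow> T_Delta_class x = 0" for x
  proof (induction rule: hideal.induct)
    case (gen a b c)
    show ?case
      by (simp only: linear_diff[OF linear_T_Delta_class] T_one_vee[symmetric] T_Delta_class_vee
          T_Delta_class_One tensor_vee_hom_assoc) simp
  qed (auto simp: linear_0[OF linear_T_Delta_class] linear_add[OF linear_T_Delta_class]
      linear_scale[OF linear_T_Delta_class] T_Delta_class_vee
      bilinear_lzero[OF bilinear_tensor_vee] bilinear_rzero[OF bilinear_tensor_vee])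
  then show "halg_eqv x y \<Longrightarrow> T_Delta_class x = T_Delta_class y" for x y
    unfolding halg_eqv_def using linear_diff[OF linear_T_Delta_class, of x y] by fastforce
qed


section \<open>Formal group-like sequences\<close>

text \<open>$A[\nu]$ is \<open>halg poly\<close>, and $(A\otimes A)[\nu]$ is identified with the tensor square of
  $A[\nu]$ over $\mathbb R[\nu]$. Linear maps extend coefficientwise by \<^const>\<open>map_poly\<close>, bilinear
  ones by the following convolution.\<close>

definition poly_bilin :: "('a::zero \<Rightarrow> 'b::zero \<Rightarrow> 'c::comm_monoid_add) \<Rightarrow> 'a poly \<Rightarrow> 'b poly \<Rightarrow> 'c poly" where
  "poly_bilin f p q = (\<Sum>i\<le>degree p. \<Sum>j\<le>degree q. monom (f (coeff p i) (coeff q j)) (i + j))"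

definition P_vee :: "halg poly \<Rightarrow> halg poly \<Rightarrow> halg poly" where
  "P_vee = poly_bilin (\<curlyvee>)"

definition P_alpha :: "halg poly \<Rightarrow> halg poly" where
  "P_alpha = map_poly halpha"

definition P_S :: "halg poly \<Rightarrow> halg poly" where
  "P_S = map_poly hS"

definition P_eps :: "halg poly \<Rightarrow> real poly" where
  "P_eps = map_poly heps"

definition P_Delta :: "halg poly \<Rightarrow> (halg, halg) tensor poly" where
  "P_Delta = map_poly hDelta"

definition P_tens :: "halg poly \<Rightarrow> halg poly \<Rightarrow> (halg, halg) tensor poly" where
  "P_tens = poly_bilin (\<otimes>)"

definition P_one :: "halg poly" where
  "P_one = [:hone:]"

text \<open>Congruence modulo $\nu^m$.\<close>

definition nu_cong :: "nat \<Rightarrow> 'a::zero poly \<Rightarrow> 'a poly \<Rightarrow> bool" where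
  "nu_cong m p q \<longleftrightarrow> (\<forall>i<m. coeff p i = coeff q i)"

text \<open>\<open>inv_cond y k\<close>: $\alpha^k\circ\vee\circ(S\otimes\mathrm{id})\circ\Delta(y)
  =\alpha^k\circ\vee\circ(\mathrm{id}\otimes S)\circ\Delta(y)=\epsilon(y)\mathbf 1$.\<close>

definition inv_cond :: "halg poly \<Rightarrow> nat \<Rightarrow> bool" where
  "inv_cond y k \<longleftrightarrow>
     (P_alpha ^^ k) (map_poly (tensor_lift (\<curlyvee>)) (map_poly (tensor_map hS id) (P_Delta y)))
       = map_poly (\<lambda>c. c *\<^sub>R hone) (P_eps y) \<and>
     (P_alpha ^^ k) (map_poly (tensor_lift (\<curlyvee>)) (map_poly (tensor_map id hS) (P_Delta y)))
       = map_poly (\<lambda>c. c *\<^sub>R hone) (P_eps y)"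

text \<open>A relation rather than a function, as the invertibility index need not exist a priori.\<close>

definition is_invertibility_index :: "halg poly \<Rightarrow> nat \<Rightarrow> bool" where
  "is_invertibility_index y k \<longleftrightarrow> inv_cond y k \<and> (\<forall>j<k. \<not> inv_cond y j)"

definition group_like :: "nat \<Rightarrow> halg poly \<Rightarrow> bool" where
  "group_like p g \<longleftrightarrow> nu_cong (p + 1) (P_Delta g) (P_tens g g) \<and> P_eps g = 1"

definition G_seq :: "(nat \<Rightarrow> halg poly) set" where
  "G_seq = {g. (\<forall>p\<ge>1. group_like p (g p)) \<and>
               (\<forall>p. nu_cong (p + 1) (g (p + 1)) (P_alpha (g p))) \<and>
               (\<exists>K. \<forall>p. \<exists>k\<le>K. is_invertibility_index (g p) k)}"

text \<open>Elements of \<open>G_seq\<close> are identified when their $p$-th terms agree modulo $\nu^{p+1}$.\<close>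

definition seq_eq :: "(nat \<Rightarrow> halg poly) \<Rightarrow> (nat \<Rightarrow> halg poly) \<Rightarrow> bool" where
  "seq_eq g h \<longleftrightarrow> (\<forall>p. nu_cong (p + 1) (g p) (h p))"

definition seq_vee :: "(nat \<Rightarrow> halg poly) \<Rightarrow> (nat \<Rightarrow> halg poly) \<Rightarrow> nat \<Rightarrow> halg poly" where
  "seq_vee g h = (\<lambda>p. P_vee (g p) (h p))"

definition seq_alpha :: "(nat \<Rightarrow> halg poly) \<Rightarrow> nat \<Rightarrow> halg poly" where
  "seq_alpha g = (\<lambda>p. P_alpha (g p))"

definition seq_S :: "(nat \<Rightarrow> halg poly) \<Rightarrow> nat \<Rightarrow> halg poly" where
  "seq_S g = (\<lambda>p. P_S (g p))"

definition seq_one :: "nat \<Rightarrow> halg poly" where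
  "seq_one = (\<lambda>p. P_one)"

text \<open>A Hom-group whose elements are compared by an equivalence relation \<open>eq\<close>, which the
  operations respect.\<close>

locale hom_group =
  fixes G :: "'g set"
    and eq :: "'g \<Rightarrow> 'g \<Rightarrow> bool"
    and vee :: "'g \<Rightarrow> 'g \<Rightarrow> 'g"
    and alpha :: "'g \<Rightarrow> 'g"
    and one :: 'g
    and inv :: "'g \<Rightarrow> 'g"
  assumes equivp_eq: "equivp eq"
    and one_closed: "one \<in> G"
    and vee_closed: "g \<in> G \<Longrightarrow> h \<in> G \<Longrightarrow> vee g h \<in> G"
    and alpha_closed: "g \<in> G \<Longrightarrow> alpha g \<in> G"
    and inv_closed: "g \<in> G \<Longrightarrow> inv g \<in> G"
    and vee_cong: "g \<in> G \<Longrightarrow> g' \<in> G \<Longrightarrow> h \<in> G \<Longrightarrow> h' \<in> G \<Longrightarrow> eq g g' \<Longrightarrow> eq h h' \<Longrightarrow>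
      eq (vee g h) (vee g' h')"
    and alpha_cong: "g \<in> G \<Longrightarrow> g' \<in> G \<Longrightarrow> eq g g' \<Longrightarrow> eq (alpha g) (alpha g')"
    and inv_cong: "g \<in> G \<Longrightarrow> g' \<in> G \<Longrightarrow> eq g g' \<Longrightarrow> eq (inv g) (inv g')"
    and hom_assoc: "g \<in> G \<Longrightarrow> h \<in> G \<Longrightarrow> k \<in> G \<Longrightarrow>
      eq (vee (vee g h) (alpha k)) (vee (alpha g) (vee h k))"
    and vee_one: "g \<in> G \<Longrightarrow> eq (vee g one) (alpha g)"
    and one_vee: "g \<in> G \<Longrightarrow> eq (vee one g) (alpha g)"
    and invertible: "g \<in> G \<Longrightarrow> \<exists>k. eq ((alpha ^^ k) (vee g (inv g))) one \<and>
      eq ((alpha ^^ k) (vee (inv g) g)) one"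


section \<open>The exponential sequence\<close>

text \<open>\<open>weigh p d t\<close> puts the weight \<open>p - (d + e)\<close> on each leaf, where \<open>e\<close> is the depth of the leaf
  in \<open>t\<close>. In $\varphi[p]$ the root edge is counted, so \<open>d = 1\<close>.\<close>

primrec weigh :: "nat \<Rightarrow> nat \<Rightarrow> unit ltree \<Rightarrow> nat ltree" where
  "weigh p d (Leaf u) = Leaf (p - d)"
| "weigh p d (Graft l r) = Graft (weigh p (d + 1) l) (weigh p (d + 1) r)"

text \<open>The common class of the trees $\varphi[p]$, for $\varphi\in T_i$; meaningful for
  $1\le i\le p$.\<close>

definition floor_e :: "nat \<Rightarrow> nat \<Rightarrow> halg" where
  "floor_e i p = (THE c. \<forall>t. leaves t = i \<longrightarrow> hclass (basis_elem (Tree (weigh p 1 t))) = c)"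

definition exp_seq :: "real \<Rightarrow> nat \<Rightarrow> halg poly" where
  "exp_seq s = (\<lambda>p. P_one + (\<Sum>i=1..p. monom ((s ^ i / fact i) *\<^sub>R floor_e i p) i))"

end

theory Submission
  imports Defs
begin

text \<open>Write $A$ for $\mathbb T/\mathcal I$, and $S*\mathrm{id}$, $\mathrm{id}*S$ for the maps
  $\vee\circ(S\otimes\mathrm{id})\circ\Delta$ and $\vee\circ(\mathrm{id}\otimes S)\circ\Delta$.

  The Hom-group. Everything except invertibility is inherited coefficient by coefficient from $A$,
  where $\Delta$ and $\epsilon$ are multiplicative and $S$ is an anti-automorphism. The invertibility
  condition on a polynomial is exact, not modulo a power of $\nu$, and it is linear: it says that all
  coefficients lie in the subspace $N_k\subseteq A$ on which $\alpha^k\circ(S*\mathrm{id})$ and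
  $\alpha^k\circ(\mathrm{id}*S)$ agree with $\epsilon(\cdot)\mathbf 1$ (\<open>inv_elems\<close>).
  The spaces $N_k$ increase with $k$. The crucial point is $N_k\vee N_k\subseteq N_{k+1}$
  (\<open>vee_inv_elems\<close>): it gives a bound for the indexes of a product that depends only on
  the bounds for its factors. It rests on the identity
  $\alpha((a\vee b)\vee(c\vee d))=(\alpha(a)\vee(b\vee c))\vee\alpha^2(d)$, which moves the inner
  factors together so that they cancel. For $g\in G_{seq}$, $g_p\vee S(g_p)$ agrees with
  $(\mathrm{id}*S)(g_p)$ modulo $\nu^{p+1}$, because $g_p$ is group-like; so some $\alpha^k$ sends it
  to $\mathbf 1$.

  The exponential. Hom-associativity rotates every tree $\varphi[p]$ with $i\le p$ leaves to the right
  comb with $i$ leaves, so the class $c_i=\lfloor e^i\rfloor_p$ is that of the comb, and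
  $c_i\vee c_j=\alpha(c_{i+j})$ whenever $i+j\le p$ (\<open>comb_vee_comb\<close>). Hence
  $\widehat{exp}(s)\vee\widehat{exp}(t)=\alpha(\widehat{exp}(s+t))$ is the binomial theorem.
  The leaves are primitive, so $\Delta(c_n)=\sum_i\binom ni c_i\otimes c_{n-i}$
  (\<open>hDelta_comb\<close>), which makes the exponential group-like, and
  $S(c_n)=(-1)^nc_n$. The alternating sum of binomial coefficients then shows that $c_n\in N_0$:
  all invertibility indexes are $0$.\<close>

section \<open>The Hom-Hopf structure of the free Hom-associative algebra\<close>

lemma linear_comp: "linear f \<Longrightarrow> linear g \<Longrightarrow> linear (\<lambda>x. f (g x))"
  using linear_compose[of g f] by (simp add: o_def)

text \<open>The leaves and the unit generate the algebra, since every weighted tree is an iterated graft of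
  leaves. Identities between linear maps that preserve or reverse products thus need checking on the
  leaves and the unit only.\<close>

lemma halg_induct [case_names add scale one leaf vee]:
  assumes add: "\<And>x y. P x \<Longrightarrow> P y \<Longrightarrow> P (x + y)"
    and scale: "\<And>c x. P x \<Longrightarrow> P (c *\<^sub>R x)"
    and one: "P hone"
    and leaf: "\<And>a. P (bcls (Tree (Leaf a)))"
    and vee: "\<And>x y. P x \<Longrightarrow> P y \<Longrightarrow> P (x \<curlyvee> y)"
  shows "P x"
proof -
  have tree: "P (bcls (Tree t))" for t
  proof (induction t)
    case (Graft l r)
    then show ?case using vee[OF Graft] by (simp add: bcls_vee)
  qed (rule leaf)
  have basis: "P (bcls b)" for b
    using one tree by (cases b) (auto simp: hone_def)
  have zero: "P 0"
    using scale[OF one, of 0] by simp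
  obtain y where y: "x = hclass y"
    using hclass_surj by blast
  have "hclass y = hclass (lin_ext basis_elem y)"
    by (simp flip: lin_ext_expand)
  also have "\<dots> = (\<Sum>k\<in>Poly_Mapping.keys y. Poly_Mapping.lookup y k *\<^sub>R bcls k)"
    by (simp add: lin_ext_def linear_sum[OF linear_hclass] linear_scale[OF linear_hclass])
  also have "P \<dots>"
    by (induction rule: infinite_finite_induct) (auto intro: add zero scale basis)
  finally show ?thesis by (simp add: y)
qed

lemma hDelta_hclass: "hDelta (hclass x) = T_Delta_class x"
  by (simp add: hclass_def hDelta.abs_eq)

lemma linear_hDelta: "linear hDelta"
proof (rule linearI)
  show "hDelta (x + y) = hDelta x + hDelta y" for x y
    using hclass_surj[of x] hclass_surj[of y]
    by (auto simp: hDelta_hclass linear_add[OF linear_T_Delta_class] simp flip: linear_add[OF linear_hclass])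
  show "hDelta (c *\<^sub>R x) = c *\<^sub>R hDelta x" for c x
    using hclass_surj[of x]
    by (auto simp: hDelta_hclass linear_scale[OF linear_T_Delta_class] simp flip: linear_scale[OF linear_hclass])
qed

lemma hDelta_vee: "hDelta (x \<curlyvee> y) = tensor_vee (hDelta x) (hDelta y)"
  using hclass_surj[of x] hclass_surj[of y]
  by (auto simp: hDelta_hclass hclass_vee T_Delta_class_vee)

lemma hDelta_hone: "hDelta hone = hone \<otimes> hone"
  by (simp add: hone_def hDelta_hclass T_Delta_class_One)

lemma hDelta_leaf:
  "hDelta (bcls (Tree (Leaf a))) = bcls (Tree (Leaf a)) \<otimes> hone + hone \<otimes> bcls (Tree (Leaf a))"
proof -
  have "Pow {Suc 0..Suc 0} = {{}, {Suc 0}}" by auto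
  then show ?thesis
    by (simp add: hDelta_hclass T_Delta_class_Tree hone_def)
qed

lemma heps_hclass: "heps (hclass x) = T_eps x"
  by (simp add: hclass_def heps.abs_eq)

lemma linear_heps: "linear heps"
proof (rule linearI)
  show "heps (x + y) = heps x + heps y" for x y
    using hclass_surj[of x] hclass_surj[of y]
    by (auto simp: heps_hclass linear_add[OF linear_T_eps] simp flip: linear_add[OF linear_hclass])
  show "heps (c *\<^sub>R x) = c *\<^sub>R heps x" for c x
    using hclass_surj[of x]
    by (auto simp: heps_hclass linear_scale[OF linear_T_eps] simp flip: linear_scale[OF linear_hclass])
qed

lemma heps_vee: "heps (x \<curlyvee> y) = heps x * heps y"
  using hclass_surj[of x] hclass_surj[of y] by (auto simp: heps_hclass hclass_vee T_eps_vee)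

lemma heps_hone [simp]: "heps hone = 1"
  by (simp add: hone_def heps_hclass T_eps_def)

lemma heps_leaf: "heps (bcls (Tree (Leaf a))) = 0"
  by (simp add: heps_hclass T_eps_def)

lemma hS_hclass: "hS (hclass x) = hclass (T_S x)"
  by (simp add: hclass_def hS.abs_eq)

lemma linear_hS: "linear hS"
proof (rule linearI)
  show "hS (x + y) = hS x + hS y" for x y
    using hclass_surj[of x] hclass_surj[of y]
    by (auto simp: hS_hclass linear_add[OF linear_T_S] simp flip: linear_add[OF linear_hclass])
  show "hS (c *\<^sub>R x) = c *\<^sub>R hS x" for c x
    using hclass_surj[of x]
    by (auto simp: hS_hclass linear_scale[OF linear_T_S] simp flip: linear_scale[OF linear_hclass])
qed

lemma hS_vee: "hS (x \<curlyvee> y) = hS y \<curlyvee> hS x"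
  using hclass_surj[of x] hclass_surj[of y] by (auto simp: hS_hclass hclass_vee T_S_vee)

lemma hS_hone [simp]: "hS hone = hone"
  by (simp add: hone_def hS_hclass)

lemma hS_leaf: "hS (bcls (Tree (Leaf a))) = - bcls (Tree (Leaf a))"
  by (simp add: hS_hclass linear_neg[OF linear_hclass])

lemma halpha_hone [simp]: "halpha hone = hone"
  by (simp add: hone_def halpha_hclass)

lemma halpha_vee: "halpha (x \<curlyvee> y) = halpha x \<curlyvee> halpha y"
  using hclass_surj[of x] hclass_surj[of y] by (auto simp: halpha_hclass hclass_vee T_alpha_vee)

lemma halpha_leaf: "halpha (bcls (Tree (Leaf a))) = bcls (Tree (Leaf (Suc a)))"
  by (simp add: halpha_hclass)

lemma halpha_hS: "halpha (hS x) = hS (halpha x)"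
  using hS_vee[of hone x] by (simp add: hone_vee vee_hone)

lemma hS_hS [simp]: "hS (hS x) = x"
  by (induction x rule: halg_induct)
     (simp_all add: linear_add[OF linear_hS] linear_scale[OF linear_hS] linear_neg[OF linear_hS] hS_leaf hS_vee)

lemma linear_tensor_vee: "linear (tensor_vee t)" "linear (\<lambda>t. tensor_vee t u)"
  using bilinear_tensor_vee by (auto simp: bilinear_def)

lemma tensor_map_hS_tensor_vee:
  "tensor_map hS hS (tensor_vee t u) = tensor_vee (tensor_map hS hS u) (tensor_map hS hS t)"
proof -
  note lm = linear_tensor_map[of hS hS]
  have "tensor_map hS hS (tensor_vee (a \<otimes> b) u) =
      tensor_vee (tensor_map hS hS u) (tensor_map hS hS (a \<otimes> b))" for a b
    by (rule linear_tensor_eq[OF linear_comp[OF lm linear_tensor_vee(1)]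
          linear_comp[OF linear_tensor_vee(2) lm]])
       (simp add: tensor_vee_tens tensor_map_tens linear_hS hS_vee)
  then show ?thesis
    by (rule linear_tensor_eq[OF linear_comp[OF lm linear_tensor_vee(2)]
          linear_comp[OF linear_tensor_vee(1) lm]])
qed

text \<open>No flip of the tensor factors appears although $S$ reverses products: $S$ is $-1$ on the
  leaves, which are primitive, so $\Delta\circ S$ and $(S\otimes S)\circ\Delta$ are anti-multiplicative
  maps that agree on generators.\<close>

lemma hDelta_hS: "hDelta (hS x) = tensor_map hS hS (hDelta x)"
proof (induction x rule: halg_induct)
  case (leaf a)
  show ?case
    by (simp add: hS_leaf hDelta_leaf linear_neg[OF linear_hDelta] linear_add[OF linear_tensor_map]
        tensor_map_tens linear_hS bilinear_lneg[OF bilinear_tens] bilinear_rneg[OF bilinear_tens])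
qed (simp_all add: linear_add[OF linear_hS] linear_scale[OF linear_hS] linear_add[OF linear_hDelta]
    linear_scale[OF linear_hDelta] linear_add[OF linear_tensor_map] linear_scale[OF linear_tensor_map]
    hDelta_hone tensor_map_tens linear_hS hS_vee hDelta_vee tensor_map_hS_tensor_vee)

section \<open>Elements of bounded invertibility index\<close>

text \<open>Composed with the coproduct, these are the convolutions $S*\mathrm{id}$ and
  $\mathrm{id}*S$. They are defined on all tensors so that identities can be checked on pure
  tensors.\<close>

definition antipode_left :: "(halg, halg) tensor \<Rightarrow> halg" where
  "antipode_left t = tensor_lift (\<curlyvee>) (tensor_map hS id t)"

definition antipode_right :: "(halg, halg) tensor \<Rightarrow> halg" where
  "antipode_right t = tensor_lift (\<curlyvee>) (tensor_map id hS t)"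

lemma linear_antipode: "linear antipode_left" "linear antipode_right"
  unfolding antipode_left_def antipode_right_def
  by (rule linear_comp[OF linear_tensor_lift linear_tensor_map])+

lemma antipode_tens: "antipode_left (a \<otimes> b) = hS a \<curlyvee> b" "antipode_right (a \<otimes> b) = a \<curlyvee> hS b"
  by (simp_all add: antipode_left_def antipode_right_def tensor_map_tens linear_hS
      linear_id tensor_lift_tens bilinear_hvee)

lemma linear_halpha_pow: "linear (halpha ^^ k)"
proof (induction k)
  case (Suc k)
  then show ?case using linear_comp[OF linear_halpha Suc] by (simp add: o_def)
qed (simp add: linearI)

lemmas lin_simps =
  linear_add[OF linear_halpha] linear_scale[OF linear_halpha]
  linear_add[OF linear_halpha_pow] linear_scale[OF linear_halpha_pow]
  linear_add[OF linear_antipode(1)] linear_scale[OF linear_antipode(1)]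
  linear_add[OF linear_antipode(2)] linear_scale[OF linear_antipode(2)]
  linear_add[OF linear_tensor_vee(1)] linear_scale[OF linear_tensor_vee(1)]
  linear_add[OF linear_tensor_vee(2)] linear_scale[OF linear_tensor_vee(2)]
  linear_add[OF linear_hvee(1)] linear_scale[OF linear_hvee(1)]
  linear_add[OF linear_hvee(2)] linear_scale[OF linear_hvee(2)]
  linear_add[OF linear_hDelta] linear_scale[OF linear_hDelta]
  linear_add[OF linear_heps] linear_scale[OF linear_heps]
  linear_add[OF linear_hS] linear_scale[OF linear_hS]
  linear_add[OF linear_tensor_map] linear_scale[OF linear_tensor_map]

lemma antipode_hS:
  "antipode_left (tensor_map hS hS t) = antipode_right t"
  "antipode_right (tensor_map hS hS t) = antipode_left t"
proof -
  show "antipode_left (tensor_map hS hS t) = antipode_right t"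
  proof (rule linear_tensor_eq[where t = t])
    show "linear (\<lambda>t. antipode_left (tensor_map hS hS t))" "linear (\<lambda>t. antipode_right t)"
      by (rule linearI; simp only: lin_simps)+
  qed (simp add: tensor_map_tens linear_hS antipode_tens)
  show "antipode_right (tensor_map hS hS t) = antipode_left t"
  proof (rule linear_tensor_eq[where t = t])
    show "linear (\<lambda>t. antipode_right (tensor_map hS hS t))" "linear (\<lambda>t. antipode_left t)"
      by (rule linearI; simp only: lin_simps)+
  qed (simp add: tensor_map_tens linear_hS antipode_tens)
qed

text \<open>One application of $\alpha$ is the price of rebracketing so that $b$ meets $c$. In the convolution
  of a product of two elements, $b$ and $c$ come from the same element.\<close>

lemma halpha_vee_vee:
  "halpha ((a \<curlyvee> b) \<curlyvee> (c \<curlyvee> d)) = (halpha a \<curlyvee> (b \<curlyvee> c)) \<curlyvee> halpha (halpha d)"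
proof -
  have "halpha ((a \<curlyvee> b) \<curlyvee> (c \<curlyvee> d)) = halpha (a \<curlyvee> b) \<curlyvee> (halpha c \<curlyvee> halpha d)"
    by (simp only: halpha_vee)
  also have "\<dots> = ((a \<curlyvee> b) \<curlyvee> halpha c) \<curlyvee> halpha (halpha d)"
    by (rule hvee_hom_assoc[symmetric])
  also have "(a \<curlyvee> b) \<curlyvee> halpha c = halpha a \<curlyvee> (b \<curlyvee> c)"
    by (rule hvee_hom_assoc)
  finally show ?thesis .
qed

lemma halpha_antipode_left_vee:
  "halpha (antipode_left (tensor_vee t (c \<otimes> d))) =
   (halpha (hS c) \<curlyvee> antipode_left t) \<curlyvee> halpha (halpha d)"
proof (rule linear_tensor_eq[where t = t])
  show "linear (\<lambda>t. halpha (antipode_left (tensor_vee t (c \<otimes> d))))"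
    "linear (\<lambda>t. (halpha (hS c) \<curlyvee> antipode_left t) \<curlyvee> halpha (halpha d))"
    by (rule linearI; simp add: lin_simps)+
qed (simp add: tensor_vee_tens antipode_tens hS_vee halpha_vee_vee)

lemma halpha_antipode_right_vee:
  "halpha (antipode_right (tensor_vee (a \<otimes> b) u)) =
   (halpha a \<curlyvee> antipode_right u) \<curlyvee> halpha (halpha (hS b))"
proof (rule linear_tensor_eq[where t = u])
  show "linear (\<lambda>u. halpha (antipode_right (tensor_vee (a \<otimes> b) u)))"
    "linear (\<lambda>u. (halpha a \<curlyvee> antipode_right u) \<curlyvee> halpha (halpha (hS b)))"
    by (rule linearI; simp add: lin_simps)+
qed (simp add: tensor_vee_tens antipode_tens hS_vee halpha_vee_vee)

lemma halpha_pow_vee: "(halpha ^^ k) (x \<curlyvee> y) = (halpha ^^ k) x \<curlyvee> (halpha ^^ k) y"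
  by (induction k) (simp_all add: halpha_vee)

lemma halpha_pow_hone [simp]: "(halpha ^^ k) hone = hone"
  by (induction k) simp_all

lemma halpha_pow_Suc: "halpha ((halpha ^^ k) x) = (halpha ^^ k) (halpha x)"
  by (rule funpow_swap1)

lemma halpha_pow_add2: "(halpha ^^ (k + 2)) x = (halpha ^^ k) (halpha (halpha x))"
  by (simp add: halpha_pow_Suc)

text \<open>The multiple of the unit produced by the inner factors disappears into a further $\alpha$ on the
  outer ones, which then meet each other.\<close>

lemma halpha_pow_vee_central:
  assumes "(halpha ^^ k) z = e *\<^sub>R hone"
  shows "(halpha ^^ k) ((halpha a \<curlyvee> z) \<curlyvee> halpha (halpha b)) = e *\<^sub>R (halpha ^^ (k + 2)) (a \<curlyvee> b)"
  unfolding halpha_pow_add2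
  by (simp add: halpha_pow_vee assms bilinear_rmul[OF bilinear_hvee] bilinear_lmul[OF bilinear_hvee]
      vee_hone halpha_pow_Suc halpha_vee)

definition inv_elems :: "nat \<Rightarrow> halg set" where
  "inv_elems k = {x. (halpha ^^ k) (antipode_left (hDelta x)) = heps x *\<^sub>R hone \<and>
                     (halpha ^^ k) (antipode_right (hDelta x)) = heps x *\<^sub>R hone}"

lemma subspace_inv_elems: "subspace (inv_elems k)"
proof -
  have "antipode_left (hDelta 0) = 0" "antipode_right (hDelta 0) = 0" "(halpha ^^ k) 0 = 0" "heps 0 = 0"
    by (simp_all add: linear_0 linear_hDelta linear_antipode linear_halpha_pow linear_heps)
  then show ?thesis
    by (auto simp: subspace_def inv_elems_def lin_simps scaleR_add_left)
qed

lemma inv_elems_mono: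
  assumes "x \<in> inv_elems k" "k \<le> m"
  shows "x \<in> inv_elems m"
proof -
  have "(halpha ^^ m) y = (halpha ^^ (m - k)) ((halpha ^^ k) y)" for y
    using assms(2) by (metis funpow_add le_add_diff_inverse2 o_apply)
  then show ?thesis
    using assms(1) by (simp add: inv_elems_def linear_scale[OF linear_halpha_pow])
qed

text \<open>After the rebracketing, the components of $x$ (for $S*\mathrm{id}$) or of $y$ (for
  $\mathrm{id}*S$) are adjacent and collapse to the counit under $\alpha^k$. What remains is
  $\alpha^{k+2}$ of the convolution of the other factor.\<close>

lemma vee_inv_elems:
  assumes x: "x \<in> inv_elems k" and y: "y \<in> inv_elems k"
  shows "x \<curlyvee> y \<in> inv_elems (Suc k)"
proof -
  have "y \<in> inv_elems (k + 2)" "x \<in> inv_elems (k + 2)"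
    using x y by (auto intro: inv_elems_mono)
  then have e: "(halpha ^^ (k + 2)) (antipode_left (hDelta y)) = heps y *\<^sub>R hone"
    "(halpha ^^ (k + 2)) (antipode_right (hDelta x)) = heps x *\<^sub>R hone"
    by (auto simp: inv_elems_def)
  have x': "(halpha ^^ k) (antipode_left (hDelta x)) = heps x *\<^sub>R hone"
    and y': "(halpha ^^ k) (antipode_right (hDelta y)) = heps y *\<^sub>R hone"
    using x y by (auto simp: inv_elems_def)
  \<comment> \<open>The tensor of the remaining factor varies, because the rebracketing needs it to be pure and
    a coproduct is only a sum of pure tensors.\<close>
  have l: "(halpha ^^ k) (halpha (antipode_left (tensor_vee (hDelta x) u))) =
      heps x *\<^sub>R (halpha ^^ (k + 2)) (antipode_left u)" for u
  proof (rule linear_tensor_eq[where t = u])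
    show "linear (\<lambda>u. (halpha ^^ k) (halpha (antipode_left (tensor_vee (hDelta x) u))))"
      "linear (\<lambda>u. heps x *\<^sub>R (halpha ^^ (k + 2)) (antipode_left u))"
      by (rule linearI; simp only: lin_simps scaleR_add_right scaleR_left_commute)+
  qed (simp only: halpha_antipode_left_vee halpha_pow_vee_central[OF x'] antipode_tens)
  have r: "(halpha ^^ k) (halpha (antipode_right (tensor_vee t (hDelta y)))) =
      heps y *\<^sub>R (halpha ^^ (k + 2)) (antipode_right t)" for t
  proof (rule linear_tensor_eq[where t = t])
    show "linear (\<lambda>t. (halpha ^^ k) (halpha (antipode_right (tensor_vee t (hDelta y)))))"
      "linear (\<lambda>t. heps y *\<^sub>R (halpha ^^ (k + 2)) (antipode_right t))"
      by (rule linearI; simp only: lin_simps scaleR_add_right scaleR_left_commute)+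
  qed (simp only: halpha_antipode_right_vee halpha_pow_vee_central[OF y'] antipode_tens)
  show ?thesis
    unfolding inv_elems_def mem_Collect_eq funpow_Suc_right o_apply hDelta_vee l r e heps_vee
    by (simp add: mult.commute)
qed

lemma heps_hS: "heps (hS x) = heps x"
  by (induction x rule: halg_induct)
     (simp_all add: linear_add[OF linear_hS] linear_scale[OF linear_hS] linear_add[OF linear_heps]
       linear_scale[OF linear_heps] linear_neg[OF linear_heps] hS_leaf heps_leaf hS_vee heps_vee)

lemma hS_inv_elems: "x \<in> inv_elems k \<Longrightarrow> hS x \<in> inv_elems k"
  by (simp add: inv_elems_def hDelta_hS antipode_hS heps_hS)

lemma hone_inv_elems: "hone \<in> inv_elems k"
  by (simp add: inv_elems_def hDelta_hone antipode_tens hone_vee)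


section \<open>Polynomials over the algebra\<close>

lemma coeff_poly_bilin:
  assumes "\<And>y. f 0 y = 0" "\<And>x. f x 0 = 0"
  shows "coeff (poly_bilin f p q) n = (\<Sum>i\<le>n. f (coeff p i) (coeff q (n - i)))"
proof -
  have inner: "(\<Sum>j\<le>degree q. if i + j = n then f (coeff p i) (coeff q j) else 0) =
      (if i \<le> n then f (coeff p i) (coeff q (n - i)) else 0)" for i
  proof (cases "i \<le> n")
    case True
    then have "(\<Sum>j\<le>degree q. if i + j = n then f (coeff p i) (coeff q j) else 0) =
        (\<Sum>j\<le>degree q. if n - i = j then f (coeff p i) (coeff q j) else 0)"
      by (intro sum.cong) auto
    then show ?thesis
      using True assms by (auto simp: coeff_eq_0)
  qed (auto intro!: sum.neutral)
  have "coeff (poly_bilin f p q) n =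
      (\<Sum>i\<le>degree p. if i \<le> n then f (coeff p i) (coeff q (n - i)) else 0)"
    by (simp add: poly_bilin_def coeff_sum inner)
  also have "\<dots> = (\<Sum>i\<in>{..degree p} \<inter> {..n}. f (coeff p i) (coeff q (n - i)))"
    by (subst sum.inter_restrict) simp_all
  also have "\<dots> = (\<Sum>i\<le>n. f (coeff p i) (coeff q (n - i)))"
  proof (rule sum.mono_neutral_left)
    show "\<forall>i\<in>{..n} - {..degree p} \<inter> {..n}. f (coeff p i) (coeff q (n - i)) = 0"
    proof
      fix i assume "i \<in> {..n} - {..degree p} \<inter> {..n}"
      then have "coeff p i = 0" by (auto intro: coeff_eq_0)
      then show "f (coeff p i) (coeff q (n - i)) = 0" by (simp add: assms)
    qed
  qed auto
  finally show ?thesis .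
qed

lemma coeff_P_vee: "coeff (P_vee p q) n = (\<Sum>i\<le>n. coeff p i \<curlyvee> coeff q (n - i))"
  unfolding P_vee_def
  by (rule coeff_poly_bilin) (simp_all add: bilinear_lzero[OF bilinear_hvee] bilinear_rzero[OF bilinear_hvee])

lemma coeff_P_tens: "coeff (P_tens p q) n = (\<Sum>i\<le>n. coeff p i \<otimes> coeff q (n - i))"
  unfolding P_tens_def
  by (rule coeff_poly_bilin) (simp_all add: bilinear_lzero[OF bilinear_tens] bilinear_rzero[OF bilinear_tens])

lemma coeff_P_one: "coeff P_one n = (if n = 0 then hone else 0)"
  by (simp add: P_one_def coeff_pCons split: nat.split)

lemma coeff_P_maps:
  "coeff (P_alpha p) n = halpha (coeff p n)"
  "coeff (P_S p) n = hS (coeff p n)"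
  "coeff (P_eps p) n = heps (coeff p n)"
  "coeff (P_Delta p) n = hDelta (coeff p n)"
  by (simp_all add: P_alpha_def P_S_def P_eps_def P_Delta_def coeff_map_poly
      linear_0 linear_halpha linear_hS linear_heps linear_hDelta)

lemma coeff_P_alpha_pow: "coeff ((P_alpha ^^ k) p) n = (halpha ^^ k) (coeff p n)"
  by (induction k) (simp_all add: coeff_P_maps)

lemma P_one_vee: "P_vee P_one p = P_alpha p"
proof (rule poly_eqI)
  fix n
  have "coeff (P_vee P_one p) n = (\<Sum>i\<le>n. if i = 0 then halpha (coeff p n) else 0)"
    unfolding coeff_P_vee
    by (rule sum.cong) (auto simp: coeff_P_one hone_vee bilinear_lzero[OF bilinear_hvee])
  then show "coeff (P_vee P_one p) n = coeff (P_alpha p) n"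
    by (simp add: coeff_P_maps)
qed

lemma P_vee_one: "P_vee p P_one = P_alpha p"
proof (rule poly_eqI)
  fix n
  have "coeff (P_vee p P_one) n = (\<Sum>i\<le>n. if i = n then halpha (coeff p n) else 0)"
    unfolding coeff_P_vee
    by (rule sum.cong) (auto simp: coeff_P_one vee_hone bilinear_rzero[OF bilinear_hvee])
  then show "coeff (P_vee p P_one) n = coeff (P_alpha p) n"
    by (simp add: coeff_P_maps)
qed

lemma P_vee_hom_assoc: "P_vee (P_vee p q) (P_alpha r) = P_vee (P_alpha p) (P_vee q r)"
proof (rule poly_eqI)
  fix n
  have "coeff (P_vee (P_vee p q) (P_alpha r)) n =
      (\<Sum>j=0..n. \<Sum>i=0..j. (coeff p i \<curlyvee> coeff q (j - i)) \<curlyvee> halpha (coeff r (n - j)))"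
    by (simp add: coeff_P_vee coeff_P_maps linear_sum[OF linear_hvee(2)] atLeast0AtMost)
  also have "\<dots> = (\<Sum>j=0..n. \<Sum>i=0..n - j. (coeff p j \<curlyvee> coeff q i) \<curlyvee> halpha (coeff r (n - j - i)))"
    by (rule fps_mult_assoc_lemma)
  also have "\<dots> = coeff (P_vee (P_alpha p) (P_vee q r)) n"
    by (simp add: coeff_P_vee coeff_P_maps linear_sum[OF linear_hvee(1)] atLeast0AtMost hvee_hom_assoc)
  finally show "coeff (P_vee (P_vee p q) (P_alpha r)) n = coeff (P_vee (P_alpha p) (P_vee q r)) n" .
qed

lemma P_alpha_vee: "P_alpha (P_vee p q) = P_vee (P_alpha p) (P_alpha q)"
  by (rule poly_eqI) (simp add: coeff_P_vee coeff_P_maps linear_sum[OF linear_halpha] halpha_vee)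

lemma P_alpha_one: "P_alpha P_one = P_one"
  by (rule poly_eqI) (simp add: coeff_P_one coeff_P_maps linear_0[OF linear_halpha])

text \<open>Both sides sum over all quadruples with total \<open>n\<close>; the middle two entries are exchanged. This
  is what makes the coefficientwise extension of \<^const>\<open>tensor_vee\<close> compatible with tensoring
  polynomials.\<close>

lemma sum_quadruple_swap:
  fixes f :: "nat \<Rightarrow> nat \<Rightarrow> nat \<Rightarrow> nat \<Rightarrow> 'a::comm_monoid_add"
  shows "(\<Sum>i\<le>n. \<Sum>a\<le>i. \<Sum>b\<le>n - i. f a (i - a) b (n - i - b)) =
         (\<Sum>i\<le>n. \<Sum>a\<le>i. \<Sum>b\<le>n - i. f a b (i - a) (n - i - b))"
proof -
  let ?A = "SIGMA i:{..n}. SIGMA a:{..i}. {..n - i}"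
  let ?w = "\<lambda>(i, a, b). (a + b, a, i - a :: nat)"
  have "(\<Sum>(i, a, b)\<in>?A. f a (i - a) b (n - i - b)) = (\<Sum>(i, a, b)\<in>?A. f a b (i - a) (n - i - b))"
    by (rule sum.reindex_bij_witness[of _ ?w ?w]) (auto simp: add.commute)
  then show ?thesis
    by (simp add: sum.Sigma)
qed

section \<open>Congruences and group-like polynomials\<close>

lemma nu_cong_iff: "nu_cong (p + 1) f g \<longleftrightarrow> (\<forall>n\<le>p. coeff f n = coeff g n)"
  by (auto simp: nu_cong_def less_Suc_eq_le)

lemma nu_cong_vee:
  "nu_cong m f f' \<Longrightarrow> nu_cong m g g' \<Longrightarrow> nu_cong m (P_vee f g) (P_vee f' g')"
  by (auto simp: nu_cong_def coeff_P_vee intro!: sum.cong)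

lemma group_like_iff:
  "group_like p g \<longleftrightarrow>
     (\<forall>n\<le>p. hDelta (coeff g n) = (\<Sum>i\<le>n. coeff g i \<otimes> coeff g (n - i))) \<and>
     (\<forall>n. heps (coeff g n) = (if n = 0 then 1 else 0))"
proof -
  have "P_eps g = 1 \<longleftrightarrow> (\<forall>n. heps (coeff g n) = (if n = 0 then 1 else 0))"
    by (auto simp: poly_eq_iff coeff_P_maps)
  then show ?thesis
    unfolding group_like_def nu_cong_iff by (simp only: coeff_P_maps coeff_P_tens)
qed

lemma sum_delta_conv:
  "(\<Sum>i\<le>n. (if i = 0 then 1 else 0) * (if n - i = 0 then 1 else (0::real))) = (if n = (0::nat) then 1 else 0)"
proof -
  have "(\<Sum>i\<le>n. (if i = 0 then 1 else 0) * (if n - i = 0 then 1 else (0::real))) =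
      (\<Sum>i\<le>n. if i = 0 then (if n = 0 then 1 else 0) else 0)"
    by (rule sum.cong) auto
  then show ?thesis by simp
qed

lemma group_like_vee:
  assumes "group_like p g" "group_like p h"
  shows "group_like p (P_vee g h)"
  unfolding group_like_iff
proof (intro conjI allI impI)
  fix n assume n: "n \<le> p"
  have g: "hDelta (coeff g i) = (\<Sum>a\<le>i. coeff g a \<otimes> coeff g (i - a))" if "i \<le> n" for i
    using assms(1) n that by (simp add: group_like_iff)
  have h: "hDelta (coeff h i) = (\<Sum>a\<le>i. coeff h a \<otimes> coeff h (i - a))" if "i \<le> n" for i
    using assms(2) n that by (simp add: group_like_iff)
  let ?f = "\<lambda>a a' b b'. (coeff g a \<curlyvee> coeff h b) \<otimes> (coeff g a' \<curlyvee> coeff h b')"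
  have "hDelta (coeff (P_vee g h) n) =
      (\<Sum>i\<le>n. tensor_vee (hDelta (coeff g i)) (hDelta (coeff h (n - i))))"
    by (simp add: coeff_P_vee linear_sum[OF linear_hDelta] hDelta_vee)
  also have "\<dots> = (\<Sum>i\<le>n. \<Sum>a\<le>i. \<Sum>b\<le>n - i. ?f a (i - a) b (n - i - b))"
    by (rule sum.cong) (simp_all add: g h tensor_vee_sum tensor_vee_tens)
  also have "\<dots> = (\<Sum>i\<le>n. \<Sum>a\<le>i. \<Sum>b\<le>n - i. ?f a b (i - a) (n - i - b))"
    by (rule sum_quadruple_swap)
  also have "\<dots> = (\<Sum>i\<le>n. coeff (P_vee g h) i \<otimes> coeff (P_vee g h) (n - i))"
    by (simp add: coeff_P_vee bilinear_sum[OF bilinear_tens] sum.cartesian_product)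
  finally show "hDelta (coeff (P_vee g h) n) =
      (\<Sum>i\<le>n. coeff (P_vee g h) i \<otimes> coeff (P_vee g h) (n - i))" .
next
  fix n
  have e: "heps (coeff g i) = (if i = 0 then 1 else 0)" "heps (coeff h i) = (if i = 0 then 1 else 0)" for i
    using assms by (simp_all add: group_like_iff)
  show "heps (coeff (P_vee g h) n) = (if n = 0 then 1 else 0)"
    by (simp only: coeff_P_vee linear_sum[OF linear_heps] heps_vee e sum_delta_conv)
qed

lemma group_like_one: "group_like p P_one"
  unfolding group_like_iff
proof (intro conjI allI impI)
  fix n
  have "(\<Sum>i\<le>n. coeff P_one i \<otimes> coeff P_one (n - i)) =
      (\<Sum>i\<le>n. if i = 0 then (if n = 0 then hone \<otimes> hone else 0) else 0)"
    by (rule sum.cong)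
       (auto simp: coeff_P_one bilinear_lzero[OF bilinear_tens] bilinear_rzero[OF bilinear_tens])
  then show "hDelta (coeff P_one n) = (\<Sum>i\<le>n. coeff P_one i \<otimes> coeff P_one (n - i))"
    by (simp add: coeff_P_one hDelta_hone linear_0[OF linear_hDelta])
qed (simp_all add: coeff_P_one linear_0[OF linear_heps])

lemma group_like_S: "group_like p g \<Longrightarrow> group_like p (P_S g)"
  by (simp add: group_like_iff coeff_P_maps hDelta_hS heps_hS linear_sum[OF linear_tensor_map]
      tensor_map_tens linear_hS)

lemma inv_cond_iff: "inv_cond y k \<longleftrightarrow> (\<forall>n. coeff y n \<in> inv_elems k)"
  by (auto simp: inv_cond_def poly_eq_iff coeff_P_alpha_pow coeff_map_poly coeff_P_maps inv_elems_def
      antipode_left_def antipode_right_def linear_0[OF linear_tensor_map] linear_0[OF linear_tensor_lift])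

text \<open>The conditions \<open>inv_cond y k\<close> are monotone in \<open>k\<close>, so a bound for the least index is the
  same as the condition at the bound.\<close>

lemma ex_index_le_iff: "(\<exists>k\<le>K. is_invertibility_index y k) \<longleftrightarrow> inv_cond y K"
proof
  assume "inv_cond y K"
  then have "is_invertibility_index y (LEAST k. inv_cond y k)" "(LEAST k. inv_cond y k) \<le> K"
    by (auto simp: is_invertibility_index_def intro: LeastI Least_le dest: not_less_Least)
  then show "\<exists>k\<le>K. is_invertibility_index y k" by blast
qed (auto simp: is_invertibility_index_def inv_cond_iff intro: inv_elems_mono)

lemma G_seq_iff:
  "g \<in> G_seq \<longleftrightarrow> (\<forall>p\<ge>1. group_like p (g p)) \<and>
     (\<forall>p. nu_cong (p + 1) (g (p + 1)) (P_alpha (g p))) \<and>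
     (\<exists>K. \<forall>p n. coeff (g p) n \<in> inv_elems K)"
  by (simp add: G_seq_def ex_index_le_iff inv_cond_iff)

text \<open>Up to the order $p$, the coproduct of a group-like \<open>g\<close> is $g\otimes g$, so the exact
  convolution conditions turn into conditions on $g\vee S(g)$ and $S(g)\vee g$.\<close>

lemma group_like_inverse:
  assumes "group_like p g" "\<And>n. coeff g n \<in> inv_elems K"
  shows "nu_cong (p + 1) ((P_alpha ^^ K) (P_vee g (P_S g))) P_one"
    and "nu_cong (p + 1) ((P_alpha ^^ K) (P_vee (P_S g) g)) P_one"
proof -
  have "coeff ((P_alpha ^^ K) (P_vee g (P_S g))) n = coeff P_one n \<and>
      coeff ((P_alpha ^^ K) (P_vee (P_S g) g)) n = coeff P_one n" if "n \<le> p" for n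
  proof -
    have d: "hDelta (coeff g n) = (\<Sum>i\<le>n. coeff g i \<otimes> coeff g (n - i))"
      and e: "heps (coeff g n) = (if n = 0 then 1 else 0)"
      using assms(1) that by (auto simp: group_like_iff)
    have "coeff (P_vee g (P_S g)) n = antipode_right (hDelta (coeff g n))"
      "coeff (P_vee (P_S g) g) n = antipode_left (hDelta (coeff g n))"
      by (simp_all add: d coeff_P_vee coeff_P_maps linear_sum[OF linear_antipode(1)]
          linear_sum[OF linear_antipode(2)] antipode_tens)
    then show ?thesis
      using assms(2)[of n] by (simp add: coeff_P_alpha_pow inv_elems_def e coeff_P_one)
  qed
  then show "nu_cong (p + 1) ((P_alpha ^^ K) (P_vee g (P_S g))) P_one"
    "nu_cong (p + 1) ((P_alpha ^^ K) (P_vee (P_S g) g)) P_one"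
    unfolding nu_cong_iff by blast+
qed

section \<open>The Hom-group of formal group-like sequences\<close>

lemma seq_eq_iff: "seq_eq g h \<longleftrightarrow> (\<forall>p. \<forall>n\<le>p. coeff (g p) n = coeff (h p) n)"
  unfolding seq_eq_def nu_cong_iff ..

lemma seq_alpha_pow: "(seq_alpha ^^ k) g p = (P_alpha ^^ k) (g p)"
  by (induction k arbitrary: g) (simp_all add: seq_alpha_def)

lemma one_G_seq: "seq_one \<in> G_seq"
proof -
  have "coeff P_one n \<in> inv_elems 0" for n
    using hone_inv_elems subspace_0[OF subspace_inv_elems] by (simp add: coeff_P_one)
  then show ?thesis
    by (auto simp: G_seq_iff seq_one_def group_like_one P_alpha_one nu_cong_def)
qed

lemma vee_G_seq:
  assumes g: "g \<in> G_seq" and h: "h \<in> G_seq"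
  shows "seq_vee g h \<in> G_seq"
proof -
  obtain K L where K: "\<And>p n. coeff (g p) n \<in> inv_elems K" and L: "\<And>p n. coeff (h p) n \<in> inv_elems L"
    using g h unfolding G_seq_iff by blast
  have "coeff (P_vee (g p) (h p)) n \<in> inv_elems (Suc (max K L))" for p n
    unfolding coeff_P_vee
    by (intro subspace_sum[OF subspace_inv_elems] vee_inv_elems inv_elems_mono[OF K] inv_elems_mono[OF L]) auto
  moreover have "nu_cong (p + 1) (P_vee (g (p + 1)) (h (p + 1))) (P_alpha (P_vee (g p) (h p)))" for p
    unfolding P_alpha_vee using g h by (intro nu_cong_vee) (auto simp: G_seq_iff)
  ultimately show ?thesis
    using g h unfolding G_seq_iff seq_vee_def by (blast intro: group_like_vee)
qed

lemma seq_one_vee: "seq_vee seq_one g = seq_alpha g"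
  by (simp add: seq_vee_def seq_one_def seq_alpha_def P_one_vee)

lemma seq_vee_one: "seq_vee g seq_one = seq_alpha g"
  by (simp add: seq_vee_def seq_one_def seq_alpha_def P_vee_one)

lemma S_G_seq:
  assumes g: "g \<in> G_seq"
  shows "seq_S g \<in> G_seq"
proof -
  obtain K where K: "\<And>p n. coeff (g p) n \<in> inv_elems K"
    using g unfolding G_seq_iff by blast
  have "coeff (P_S (g p)) n \<in> inv_elems K" for p n
    using K by (simp add: coeff_P_maps hS_inv_elems)
  moreover have "nu_cong (p + 1) (P_S (g (p + 1))) (P_alpha (P_S (g p)))" for p
    using g by (simp add: G_seq_iff nu_cong_def coeff_P_maps halpha_hS)
  ultimately show ?thesis
    using g unfolding G_seq_iff seq_S_def by (blast intro: group_like_S)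
qed

text \<open>Group-likeness is a condition on $g_p$ for $p\ge1$, so $g_0$ is treated through
  $\alpha(g_0)\equiv g_1$ modulo $\nu$, at the cost of one more $\alpha$: hence the exponent
  \<open>Suc K\<close>.\<close>

lemma G_seq_invertible:
  assumes g: "g \<in> G_seq"
  shows "\<exists>k. seq_eq ((seq_alpha ^^ k) (seq_vee g (seq_S g))) seq_one \<and>
      seq_eq ((seq_alpha ^^ k) (seq_vee (seq_S g) g)) seq_one"
proof -
  obtain K where K: "\<And>p n. coeff (g p) n \<in> inv_elems K"
    using g unfolding G_seq_iff by blast
  have "nu_cong (p + 1) ((P_alpha ^^ Suc K) (P_vee (g p) (P_S (g p)))) P_one \<and>
      nu_cong (p + 1) ((P_alpha ^^ Suc K) (P_vee (P_S (g p)) (g p))) P_one" for p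
  proof (cases "p = 0")
    case False
    then have "group_like p (g p)"
      using g by (simp add: G_seq_iff)
    then show ?thesis
      using group_like_inverse[of p "g p" "Suc K"] inv_elems_mono[OF K, of "Suc K"] by simp
  next
    case True
    have "group_like 1 (g 1)" and g1: "coeff (g 1) 0 = halpha (coeff (g 0) 0)"
      using g by (auto simp: G_seq_iff nu_cong_def coeff_P_maps)
    then have "coeff ((P_alpha ^^ K) (P_vee (g 1) (P_S (g 1)))) 0 = coeff P_one 0"
      "coeff ((P_alpha ^^ K) (P_vee (P_S (g 1)) (g 1))) 0 = coeff P_one 0"
      using group_like_inverse[of 1 "g 1" K] K unfolding nu_cong_iff by blast+
    then show ?thesis
      unfolding True nu_cong_iff
      by (simp add: coeff_P_alpha_pow coeff_P_vee coeff_P_maps g1[unfolded One_nat_def]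
          halpha_pow_Suc halpha_vee flip: halpha_hS)
  qed
  then show ?thesis
    unfolding seq_eq_def
    by (intro exI[of _ "Suc K"])
       (simp add: seq_alpha_pow seq_vee_def seq_S_def seq_one_def del: funpow.simps)
qed

lemma hom_group_G_seq: "hom_group G_seq seq_eq seq_vee seq_alpha seq_one seq_S"
proof
  show "equivp seq_eq"
    by (rule equivpI) (auto simp: seq_eq_iff reflp_def symp_def transp_def)
  show "seq_one \<in> G_seq" by (rule one_G_seq)
  show "seq_alpha g \<in> G_seq" if "g \<in> G_seq" for g
    using vee_G_seq[OF one_G_seq that] by (simp add: seq_one_vee)
  show "seq_eq (seq_vee g h) (seq_vee g' h')" if "seq_eq g g'" "seq_eq h h'" for g g' h h'
    using that by (simp add: seq_eq_def seq_vee_def nu_cong_vee)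
  show "seq_eq (seq_alpha g) (seq_alpha g')" "seq_eq (seq_S g) (seq_S g')" if "seq_eq g g'" for g g'
    using that by (simp_all add: seq_eq_iff seq_alpha_def seq_S_def coeff_P_maps)
  show "seq_eq (seq_vee (seq_vee g h) (seq_alpha k)) (seq_vee (seq_alpha g) (seq_vee h k))" for g h k
    by (simp add: seq_eq_iff seq_vee_def seq_alpha_def P_vee_hom_assoc)
  show "\<exists>k. seq_eq ((seq_alpha ^^ k) (seq_vee g (seq_S g))) seq_one \<and>
      seq_eq ((seq_alpha ^^ k) (seq_vee (seq_S g) g)) seq_one" if "g \<in> G_seq" for g
    by (rule G_seq_invertible[OF that])
qed (simp_all add: vee_G_seq S_G_seq seq_vee_one seq_one_vee seq_eq_iff)

section \<open>Classes of the weighted trees of the exponential\<close>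

text \<open>The class of the right comb with \<open>i\<close> leaves and weights $m$ minus the depth, the root edge
  not being counted; so the comb of $\lfloor e^i\rfloor_p$ has \<open>m = p - 1\<close>. The value at \<open>i = 0\<close>
  makes \<open>comb i (p - 1)\<close> the coefficient of $s^i\nu^i/i!$ in $\widehat{exp}_p(s)$ for $i=0$ as well.
  Truncated subtraction does no harm as long as \<open>i \<le> m + 1\<close>.\<close>

fun comb :: "nat \<Rightarrow> nat \<Rightarrow> halg" where
  "comb 0 m = hone"
| "comb (Suc 0) m = bcls (Tree (Leaf m))"
| "comb (Suc (Suc i)) m = bcls (Tree (Leaf (m - 1))) \<curlyvee> comb (Suc i) (m - 1)"

lemma halpha_comb: "i \<le> Suc m \<Longrightarrow> halpha (comb i m) = comb i (Suc m)"
  by (induction i m rule: comb.induct) (auto simp: halpha_leaf halpha_vee)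

lemma comb_Suc_vee: "i \<le> Suc m \<Longrightarrow> comb (Suc 0) m \<curlyvee> comb i m = comb (Suc i) (Suc m)"
  by (cases i) (simp_all add: vee_hone halpha_leaf)

text \<open>Hom-associativity moves the leaves of the left comb one at a time to the right one. The right
  comb has to be of the form $\alpha(\cdot)$ for this, which the bound on $i+j$ ensures: its weights are
  positive as long as the left comb has more than one leaf.\<close>

lemma comb_vee_comb_pos:
  assumes "0 < i" "0 < j" "i + j \<le> Suc (Suc m)"
  shows "comb i m \<curlyvee> comb j m = comb (i + j) (Suc m)"
  using assms
proof (induction i m rule: comb.induct)
  case (2 m)
  then show ?case by (cases j) simp_all
next
  case (3 i m)
  then obtain m' where m: "m = Suc m'" by (cases m) auto
  have "comb (Suc (Suc i)) m \<curlyvee> comb j m = (comb 1 m' \<curlyvee> comb (Suc i) m') \<curlyvee> halpha (comb j m')"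
    using 3 m by (simp add: halpha_comb)
  also have "\<dots> = halpha (comb 1 m') \<curlyvee> (comb (Suc i) m' \<curlyvee> comb j m')"
    by (rule hvee_hom_assoc)
  also have "\<dots> = comb 1 m \<curlyvee> comb (Suc i + j) m"
    using 3 m by (simp add: halpha_comb halpha_leaf)
  finally show ?case by simp
qed simp

lemma comb_vee_comb:
  assumes "i + j \<le> Suc m"
  shows "comb i m \<curlyvee> comb j m = halpha (comb (i + j) m)"
proof (cases "0 < i \<and> 0 < j")
  case True
  then show ?thesis
    using assms by (simp add: comb_vee_comb_pos halpha_comb)
qed (auto simp: hone_vee vee_hone)

lemma leaves_pos: "0 < leaves t"
  by (induction t) auto

text \<open>Grafting increases all depths by one, so both branches have the weights of an exponential tree
  for \<open>d + 1\<close>; by induction they are combs, and combs multiply to combs.\<close>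

lemma weigh_class:
  assumes "d \<le> p" "leaves t \<le> Suc (p - d)"
  shows "bcls (Tree (weigh p d t)) = comb (leaves t) (p - d)"
  using assms
proof (induction t arbitrary: d)
  case (Graft l r)
  have pos: "0 < leaves l" "0 < leaves r" by (rule leaves_pos)+
  have "bcls (Tree (weigh p d (Graft l r))) =
      bcls (Tree (weigh p (d + 1) l)) \<curlyvee> bcls (Tree (weigh p (d + 1) r))"
    by (simp add: bcls_vee)
  also have "\<dots> = comb (leaves l) (p - (d + 1)) \<curlyvee> comb (leaves r) (p - (d + 1))"
    using Graft.prems pos by (intro arg_cong2[where f = "(\<curlyvee>)"] Graft.IH) auto
  also have "\<dots> = comb (leaves l + leaves r) (Suc (p - (d + 1)))"
    using Graft.prems pos by (intro comb_vee_comb_pos) auto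
  also have "Suc (p - (d + 1)) = p - d"
    using Graft.prems pos by auto
  finally show ?case by simp
qed simp

lemma ex_tree_leaves: "\<exists>t :: unit ltree. leaves t = Suc i"
proof (induction i)
  case 0
  show ?case by (rule exI[of _ "Leaf ()"]) simp
next
  case (Suc i)
  then obtain t :: "unit ltree" where "leaves t = Suc i" by blast
  then show ?case by (intro exI[of _ "Graft (Leaf ()) t"]) simp
qed

lemma floor_e_eq_comb:
  assumes "1 \<le> i" "i \<le> p"
  shows "floor_e i p = comb i (p - 1)"
  unfolding floor_e_def
proof (rule the_equality)
  show all: "\<forall>t. leaves t = i \<longrightarrow> bcls (Tree (weigh p 1 t)) = comb i (p - 1)"
    using assms by (auto intro!: weigh_class)
  fix c assume "\<forall>t. leaves t = i \<longrightarrow> bcls (Tree (weigh p 1 t)) = c"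
  moreover obtain t :: "unit ltree" where "leaves t = i"
    using ex_tree_leaves[of "i - 1"] assms by auto
  ultimately show "c = comb i (p - 1)" using all by metis
qed

lemma heps_comb: "heps (comb n m) = (if n = 0 then 1 else 0)"
  by (induction n m rule: comb.induct) (simp_all add: heps_leaf heps_vee)

lemma hS_comb: "n \<le> Suc m \<Longrightarrow> hS (comb n m) = (- 1) ^ n *\<^sub>R comb n m"
proof (induction n m rule: comb.induct)
  case (3 i m)
  then obtain m' where m: "m = Suc m'" by (cases m) auto
  have "hS (comb (Suc (Suc i)) m) = (- 1) ^ Suc (Suc i) *\<^sub>R (comb (Suc i) m' \<curlyvee> comb (Suc 0) m')"
    using 3 m by (simp add: hS_vee hS_leaf bilinear_lmul[OF bilinear_hvee]
        bilinear_rneg[OF bilinear_hvee] bilinear_lneg[OF bilinear_hvee])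
  also have "comb (Suc i) m' \<curlyvee> comb (Suc 0) m' = comb (Suc (Suc i)) m"
    using 3 m by (subst comb_vee_comb_pos) auto
  finally show ?case .
qed (simp_all add: hS_leaf)

lemma sum_binomial_Suc:
  fixes f :: "nat \<Rightarrow> 'a::real_vector"
  shows "(\<Sum>i\<le>Suc n. real (Suc n choose i) *\<^sub>R f i) = (\<Sum>i\<le>n. real (n choose i) *\<^sub>R (f (Suc i) + f i))"
proof -
  have "(\<Sum>i\<le>n. real (n choose Suc i) *\<^sub>R f (Suc i)) + f 0 = (\<Sum>i\<le>Suc n. real (n choose i) *\<^sub>R f i)"
    by (simp only: sum.atMost_Suc_shift) simp
  also have "\<dots> = (\<Sum>i\<le>n. real (n choose i) *\<^sub>R f i)"
    by simp
  finally show ?thesis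
    by (subst sum.atMost_Suc_shift) (simp add: scaleR_add_left scaleR_add_right sum.distrib add_ac)
qed

text \<open>The leaf grafted on the left is primitive, so it goes to either tensor factor: this is
  Pascal's rule.\<close>

lemma hDelta_comb:
  "n \<le> Suc m \<Longrightarrow> hDelta (comb n m) = (\<Sum>i\<le>n. real (n choose i) *\<^sub>R (comb i m \<otimes> comb (n - i) m))"
proof (induction n m rule: comb.induct)
  case (3 i m)
  then obtain m' where m: "m = Suc m'" by (cases m) auto
  define n where "n = Suc i"
  have n: "n \<le> Suc m'" using 3 m by (simp add: n_def)
  let ?L = "comb (Suc 0) m'"
  have "hDelta (comb (Suc n) m) = tensor_vee (hDelta ?L) (hDelta (comb n m'))"
    by (simp add: n_def m hDelta_vee)
  also have "hDelta ?L = ?L \<otimes> hone + hone \<otimes> ?L"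
    by (simp add: hDelta_leaf)
  also have "hDelta (comb n m') = (\<Sum>i\<le>n. real (n choose i) *\<^sub>R (comb i m' \<otimes> comb (n - i) m'))"
    using 3 m n by (simp add: n_def)
  also have "tensor_vee (?L \<otimes> hone + hone \<otimes> ?L) \<dots> =
      (\<Sum>i\<le>n. real (n choose i) *\<^sub>R ((?L \<curlyvee> comb i m') \<otimes> halpha (comb (n - i) m') +
         halpha (comb i m') \<otimes> (?L \<curlyvee> comb (n - i) m')))"
    by (simp add: linear_sum[OF linear_tensor_vee(1)] linear_scale[OF linear_tensor_vee(1)]
        linear_add[OF linear_tensor_vee(2)] tensor_vee_tens hone_vee del: comb.simps)
  also have "\<dots> = (\<Sum>i\<le>n. real (n choose i) *\<^sub>R (comb (Suc i) m \<otimes> comb (Suc n - Suc i) m +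
         comb i m \<otimes> comb (Suc n - i) m))"
    using n by (intro sum.cong) (simp_all add: comb_Suc_vee halpha_comb m Suc_diff_le del: comb.simps)
  also have "\<dots> = (\<Sum>i\<le>Suc n. real (Suc n choose i) *\<^sub>R (comb i m \<otimes> comb (Suc n - i) m))"
    by (rule sum_binomial_Suc[symmetric])
  finally show ?case by (simp only: n_def)
qed (simp_all add: hDelta_hone hDelta_leaf add.commute)

text \<open>Every term of the convolution is a multiple of the same class $\alpha(c_n)$, and the multiples
  add up to $(1-1)^n$. The other convolution reduces to this one because $S(c_n)=\pm c_n$.\<close>

lemma comb_inv_elems:
  assumes "n \<le> Suc m"
  shows "comb n m \<in> inv_elems 0"
proof (cases "n = 0")
  case True
  then show ?thesis by (simp add: hone_inv_elems)
next
  case False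
  have "antipode_left (hDelta (comb n m)) =
      (\<Sum>i\<le>n. ((- 1) ^ i * real (n choose i)) *\<^sub>R halpha (comb n m))"
    unfolding hDelta_comb[OF assms] linear_sum[OF linear_antipode(1)]
  proof (rule sum.cong[OF refl])
    fix i assume "i \<in> {..n}"
    then show "antipode_left (real (n choose i) *\<^sub>R (comb i m \<otimes> comb (n - i) m)) =
        ((- 1) ^ i * real (n choose i)) *\<^sub>R halpha (comb n m)"
      using assms by (simp add: linear_scale[OF linear_antipode(1)] antipode_tens hS_comb
          bilinear_lmul[OF bilinear_hvee] comb_vee_comb mult.commute)
  qed
  also have "\<dots> = 0"
    using False choose_alternating_sum[of n, where 'a = real] by (simp flip: scaleR_sum_left)
  finally have l: "antipode_left (hDelta (comb n m)) = 0" .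
  have "antipode_right (hDelta (comb n m)) = antipode_left (hDelta (hS (comb n m)))"
    by (simp add: hDelta_hS antipode_hS)
  also have "\<dots> = 0"
    using l by (simp add: hS_comb[OF assms] linear_scale[OF linear_hDelta] linear_scale[OF linear_antipode(1)])
  finally show ?thesis
    using l False by (simp add: inv_elems_def heps_comb)
qed

section \<open>The exponential sequence\<close>

lemma coeff_exp_seq:
  "coeff (exp_seq s p) n = (if n \<le> p then (s ^ n / fact n) *\<^sub>R comb n (p - 1) else 0)"
proof -
  have "coeff (exp_seq s p) n = coeff P_one n +
      (\<Sum>i=1..p. if i = n then (s ^ i / fact i) *\<^sub>R comb i (p - 1) else 0)"
    by (auto simp: exp_seq_def coeff_sum floor_e_eq_comb intro!: sum.cong)
  then show ?thesis
    by (cases "n = 0") (auto simp: coeff_P_one)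
qed

lemma exp_coeff_add:
  fixes s t :: real
  shows "(s + t) ^ n / fact n = (\<Sum>i\<le>n. (s ^ i / fact i) * (t ^ (n - i) / fact (n - i)))"
  using exp_series_add_commuting[of s t n] by (simp add: divide_inverse mult.commute)

lemma exp_seq_vee: "seq_eq (seq_vee (exp_seq s) (exp_seq t)) (seq_alpha (exp_seq (s + t)))"
  unfolding seq_eq_iff
proof (intro allI impI)
  fix p n :: nat assume n: "n \<le> p"
  have "coeff (seq_vee (exp_seq s) (exp_seq t) p) n =
      (\<Sum>i\<le>n. ((s ^ i / fact i) * (t ^ (n - i) / fact (n - i))) *\<^sub>R halpha (comb n (p - 1)))"
    unfolding seq_vee_def coeff_P_vee
  proof (rule sum.cong[OF refl])
    fix i assume "i \<in> {..n}"
    with n have "i \<le> n" "i \<le> p" "n - i \<le> p" by auto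
    then show "coeff (exp_seq s p) i \<curlyvee> coeff (exp_seq t p) (n - i) =
        ((s ^ i / fact i) * (t ^ (n - i) / fact (n - i))) *\<^sub>R halpha (comb n (p - 1))"
      using n by (simp add: coeff_exp_seq bilinear_lmul[OF bilinear_hvee] bilinear_rmul[OF bilinear_hvee]
          comb_vee_comb mult_ac)
  qed
  also have "\<dots> = ((s + t) ^ n / fact n) *\<^sub>R halpha (comb n (p - 1))"
    by (simp only: exp_coeff_add scaleR_sum_left)
  also have "\<dots> = coeff (seq_alpha (exp_seq (s + t)) p) n"
    using n by (simp add: seq_alpha_def coeff_P_maps coeff_exp_seq linear_scale[OF linear_halpha])
  finally show "coeff (seq_vee (exp_seq s) (exp_seq t) p) n = coeff (seq_alpha (exp_seq (s + t)) p) n" .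
qed

lemma exp_seq_0: "exp_seq 0 = seq_one"
  by (rule ext, rule poly_eqI) (auto simp: seq_one_def coeff_exp_seq coeff_P_one)

lemma exp_seq_S: "seq_S (exp_seq s) = exp_seq (- s)"
proof (rule ext, rule poly_eqI)
  fix p n
  show "coeff (seq_S (exp_seq s) p) n = coeff (exp_seq (- s) p) n"
    by (auto simp: seq_S_def coeff_P_maps coeff_exp_seq linear_scale[OF linear_hS] linear_0[OF linear_hS]
        hS_comb power_minus[of s])
qed

lemma exp_seq_group_like: "group_like p (exp_seq s p)"
  unfolding group_like_iff
proof (intro conjI allI impI)
  fix n assume n: "n \<le> p"
  have "hDelta (coeff (exp_seq s p) n) =
      (\<Sum>i\<le>n. (s ^ n / fact n * real (n choose i)) *\<^sub>R (comb i (p - 1) \<otimes> comb (n - i) (p - 1)))"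
    using n by (simp add: coeff_exp_seq linear_scale[OF linear_hDelta] hDelta_comb scaleR_sum_right)
  also have "\<dots> = (\<Sum>i\<le>n. coeff (exp_seq s p) i \<otimes> coeff (exp_seq s p) (n - i))"
  proof (rule sum.cong[OF refl])
    fix i assume i: "i \<in> {..n}"
    have "s ^ n / fact n * real (n choose i) = (s ^ i / fact i) * (s ^ (n - i) / fact (n - i))"
      using i by (simp add: binomial_fact flip: power_add)
    moreover have "i \<le> p" "n - i \<le> p" using i n by auto
    ultimately show "(s ^ n / fact n * real (n choose i)) *\<^sub>R (comb i (p - 1) \<otimes> comb (n - i) (p - 1)) =
        coeff (exp_seq s p) i \<otimes> coeff (exp_seq s p) (n - i)"
      using i n by (simp add: coeff_exp_seq bilinear_lmul[OF bilinear_tens]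
          bilinear_rmul[OF bilinear_tens] mult_ac)
  qed
  finally show "hDelta (coeff (exp_seq s p) n) =
      (\<Sum>i\<le>n. coeff (exp_seq s p) i \<otimes> coeff (exp_seq s p) (n - i))" .
qed (simp add: coeff_exp_seq linear_scale[OF linear_heps] linear_0[OF linear_heps] heps_comb)

lemma exp_seq_G_seq: "exp_seq s \<in> G_seq"
  unfolding G_seq_iff
proof (intro conjI allI impI)
  show "group_like p (exp_seq s p)" for p
    by (rule exp_seq_group_like)
  show "nu_cong (p + 1) (exp_seq s (p + 1)) (P_alpha (exp_seq s p))" for p
    unfolding nu_cong_iff
  proof (intro allI impI)
    fix n assume n: "n \<le> p"
    have "halpha (comb n (p - 1)) = comb n p"
      using n by (cases p) (simp_all add: halpha_comb)
    then show "coeff (exp_seq s (p + 1)) n = coeff (P_alpha (exp_seq s p)) n"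
      using n by (simp add: coeff_P_maps coeff_exp_seq linear_scale[OF linear_halpha])
  qed
  have "coeff (exp_seq s p) n \<in> inv_elems 0" for p n
    using subspace_0[OF subspace_inv_elems]
    by (auto simp: coeff_exp_seq intro!: subspace_scale[OF subspace_inv_elems] comb_inv_elems)
  then show "\<exists>K. \<forall>p n. coeff (exp_seq s p) n \<in> inv_elems K" by blast
qed

theorem theorem5p3:
  "hom_group G_seq seq_eq seq_vee seq_alpha seq_one seq_S \<and>
   (\<forall>s::real. exp_seq s \<in> G_seq) \<and>
   seq_eq (exp_seq 0) seq_one \<and>
   (\<forall>s t::real. seq_eq (seq_vee (exp_seq s) (exp_seq t)) (seq_alpha (exp_seq (s + t)))) \<and>
   (\<forall>s::real. seq_eq (seq_S (exp_seq s)) (exp_seq (- s)) \<and>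
      seq_eq (seq_vee (exp_seq s) (exp_seq (- s))) seq_one \<and>
      seq_eq (seq_vee (exp_seq (- s)) (exp_seq s)) seq_one)"
proof -
  have "seq_eq g g" for g
    by (simp add: seq_eq_iff)
  moreover have "seq_alpha seq_one = seq_one"
    by (simp add: seq_alpha_def seq_one_def P_alpha_one)
  ultimately show ?thesis
    using hom_group_G_seq exp_seq_G_seq exp_seq_vee exp_seq_vee[of s "- s" for s] exp_seq_vee[of "- s" s for s]
    by (simp add: exp_seq_0 exp_seq_S)
qed

end
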